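(* The $DD$ bimodule $\widetilde{\mathcal X}^{DD}$ over $(\mathcal B(2),\mathcal B^!(2))$ has the following two symmetries. (1) Let $\mathcal R:\widetilde{\mathcal X}^{DD}\to\widetilde{\mathcal X}^{DD}$ be the $\mathbb F$-linear involution fixing $z_1,z_4,y_1,y_8$ and exchanging $x_1\leftrightarrow x_2$, $x_3\leftrightarrow x_6$, $x_7\leftrightarrow x_{10}$, $x_{11}\leftrightarrow x_{12}$, $y_2\leftrightarrow y_4$, $y_5\leftrightarrow y_7$. Then $\delta^1\circ\mathcal R=(\mathcal R\otimes\mathcal R)\circ\delta^1$, where $\mathcal R$ acts on $\mathcal B(2)\otimes\mathcal B^!(2)$ as the tensor product of the algebra symmetries $\mathcal R$ of the factors. (2) Let $o:\widetilde{\mathcal X}^{DD}\to(\widetilde{\mathcal X}^{DD})^\vee$ be the $\mathbb F$-linear map sending each basis element to the dual basis element of its partner under $z_1\leftrightarrow z_4$, $x_1\leftrightarrow x_{11}$, $x_2\leftrightarrow x_{12}$, $x_3\leftrightarrow x_7$, $x_6\leftrightarrow x_{10}$, $y_1\leftrightarrow y_8$, $y_2\leftrightarrow y_5$, $y_4\leftrightarrow y_7$. Then $(\delta^1)^\vee\circ o=(o\otimes o)\circ\delta^1$, where $o$ acts on $\mathcal B(2)\otimes\mathcal B^!(2)$, with values in $(\mathcal B(2)\otimes\mathcal B^!(2))^{\mathrm{op}}$, as the tensor product of the algebra symmetries $o$ of the factors.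
   Context: Let $\mathbb F=\mathbb F_2$. **Algebras.** $\mathcal B(2)$ is the $\mathbb F$-path algebra of the following quiver modulo relations. Vertices: all subsets $\mathbf x\subset\{0,1,2\}$. For $i\in\{1,2\}$: an arrow $R_i$ from $\mathbf x$ to $(\mathbf x\setminus\{i-1\})\cup\{i\}$ whenever $\mathbf x\cap\{i-1,i\}=\{i-1\}$; an arrow $L_i$ from $\mathbf x$ to $(\mathbf x\setminus\{i\})\cup\{i-1\}$ whenever $\mathbf x\cap\{i-1,i\}=\{i\}$; a loop $U_i$ at every $\mathbf x$. Paths are multiplied left to right: an arrow from $\mathbf x$ to $\mathbf y$ lies in $\mathbf I_{\mathbf x}\mathcal B(2)\mathbf I_{\mathbf y}$, where $\mathbf I_{\mathbf x}$ is the trivial path at $\mathbf x$. Relations, wherever composable: $U_i$ commutes with all labels; $R_iL_i=U_i$; $L_iR_i=U_i$; $R_1R_2=0$; $L_2L_1=0$; $U_i=0$ at $\mathbf x$ if $\mathbf x\cap\{i-1,i\}=\varnothing$. The differential is zero. $\mathcal B^!(2)$ is defined in the same way with additional loops $C_1,C_2$ at every vertex, $C_i^2=0$, $C_i$ commuting with all labels, $\partial(C_i)=U_i$. $\mathcal I(2)$ is the span of the $\mathbf I_{\mathbf x}$. Write $A=\{0\},B=\{1\},C=\{2\},AB=\{0,1\}$, etc. **Algebra symmetries.** $\mathcal R$ is the ring automorphism of $\mathcal B(2)$, and of $\mathcal B^!(2)$, with $\mathcal R(\mathbf I_{\mathbf x})=\mathbf I_{\{2-i:i\in\mathbf x\}}$,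 $R_i\leftrightarrow L_{3-i}$, $U_i\leftrightarrow U_{3-i}$, $C_i\leftrightarrow C_{3-i}$. $o$ is the isomorphism $\mathcal B(2)\to\mathcal B(2)^{\mathrm{op}}$, and $\mathcal B^!(2)\to\mathcal B^!(2)^{\mathrm{op}}$ (i.e. an anti-automorphism), fixing each $\mathbf I_{\mathbf x}$, $U_i$, $C_i$ and exchanging $R_i\leftrightarrow L_i$. **The bimodule $\widetilde{\mathcal X}^{DD}$.** It is a left $\mathcal I(2)\otimes\mathcal I(2)$-module with operation $\delta^1:\widetilde{\mathcal X}^{DD}\to(\mathcal B(2)\otimes\mathcal B^!(2))\otimes_{\mathcal I(2)\otimes\mathcal I(2)}\widetilde{\mathcal X}^{DD}$. Basis ("$(\mathbf x|\mathbf y)$" means first idempotent $\mathbf I_{\mathbf x}$, second idempotent $\mathbf I_{\mathbf y}$): $z_1=S^-_t,\ z_4=S^+_t$, both $(\varnothing|ABC)$; $x_1=S^-_t\,(A|BC)$, $x_2=S^-_t\,(C|AB)$, $x_3=W_t\,(B|BC)$, $x_6=E_b\,(B|AB)$, $x_7=W_b\,(B|BC)$, $x_{10}=E_t\,(B|AB)$, $x_{11}=S^+_t\,(A|BC)$, $x_{12}=S^+_t\,(C|AB)$; $y_1=S^-_t\,(AC|B)$, $y_2=W_t\,(BC|B)$, $y_4=E_b\,(AB|B)$, $y_5=W_b\,(BC|B)$, $y_7=E_t\,(AB|B)$, $y_8=S^+_t\,(AC|B)$. The operation ($1$ denotes the appropriate idempotent; zero on $z_1,z_4$): $x_1\mapsto(R_1\otimes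 L_1L_2)x_6+(R_1\otimes U_1C_2)x_7$; $x_2\mapsto(L_2\otimes R_2R_1)x_3+(L_2\otimes C_1U_2)x_{10}$; $x_3\mapsto(L_1\otimes1)x_1+(1\otimes L_1L_2)x_{10}+(L_1\otimes U_1C_2)x_{11}$; $x_6\mapsto(R_2\otimes1)x_2+(1\otimes R_2R_1)x_7+(R_2\otimes C_1U_2)x_{12}$; $x_7\mapsto(U_2\otimes1)x_3+(R_2\otimes L_1L_2)x_{12}$; $x_{10}\mapsto(U_1\otimes1)x_6+(L_1\otimes R_2R_1)x_{11}$; $x_{11}\mapsto(R_1\otimes1)x_7$; $x_{12}\mapsto(L_2\otimes1)x_{10}$; $y_1\mapsto(R_1U_2\otimes C_1C_2)y_2+(L_2U_1\otimes C_1C_2)y_4+(R_1\otimes U_1C_2)y_5+(L_2\otimes C_1U_2)y_7$; $y_2\mapsto(L_1\otimes1)y_1+(L_1L_2\otimes C_1C_2)y_7+(L_1\otimes U_1C_2)y_8$; $y_4\mapsto(R_2\otimes1)y_1+(R_2R_1\otimes C_1C_2)y_5+(R_2\otimes C_1U_2)y_8$; $y_5\mapsto(U_2\otimes1)y_2+(L_1L_2\otimes1)y_4+(L_1U_2\otimes C_1C_2)y_8$; $y_7\mapsto(R_2R_1\otimes1)y_2+(U_1\otimes1)y_4+(R_2U_1\otimes C_1C_2)y_8$; $y_8\mapsto(R_1\otimes1)y_5+(L_2\otimes1)y_7$. **Dual.** The dual $X^\vee$ of a finitely generated $DD$ bimodule $X$ with chosen homogeneous basis is the $DD$ bimodule over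 the opposite algebras with the dual basis (same idempotents) and operation $(\delta^1)^\vee$ obtained by reversing arrows: $(a\otimes a')\otimes x^*$ is a term of $(\delta^1)^\vee(y^* )$ exactly when $(a\otimes a')\otimes y$ is a term of $\delta^1(x)$, with $a,a'$ regarded as elements of the opposite algebras. *)

theory Defs
  imports Complex_Main "HOL-Library.Poly_Mapping" "HOL-Library.Z2" "HOL-Library.Multiset"
begin

section \<open>Vector spaces over the field with two elements\<close>

lifting_forget poly_mapping.lifting

(* Vector spaces over F_2 are the abelian groups of exponent 2; linear maps are the additive ones. *)
class f2_vs = ab_group_add +
  assumes add_self: "x + x = 0"

instance bit :: f2_vs
  by standard simp

instance poly_mapping :: (type, f2_vs) f2_vs
  by standard (rule poly_mapping_eqI, simp add: lookup_add add_self)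

lemma (in f2_vs) f2_uminus [simp]: "- x = x"
  using add_self minus_unique by blast

lemma (in f2_vs) f2_diff: "x - y = x + y"
  by (metis diff_conv_add_uminus f2_uminus)

lemma (in f2_vs) f2_add_cancel [simp]: "x + (x + y) = y"
  by (metis add.assoc add_self add_0_left)

definition f2scale :: "bit \<Rightarrow> 'v \<Rightarrow> 'v::f2_vs" where
  "f2scale c x = (if c = 1 then x else 0)"

global_interpretation f2: vector_space "f2scale :: bit \<Rightarrow> 'v \<Rightarrow> 'v::f2_vs"
  apply standard
     apply (auto simp: f2scale_def add_self)
  done

lemma f2_span_induct [consumes 1, case_names base zero add]:
  fixes x :: "'v::f2_vs"
  assumes "x \<in> f2.span S" "\<And>s. s \<in> S \<Longrightarrow> P s" "P 0" "\<And>x y. P x \<Longrightarrow> P y \<Longrightarrow> P (x + y)"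
  shows "P x"
  using assms(1)
  by (induction rule: f2.span_induct_alt) (auto simp: f2scale_def assms)

lemma equivp_span:
  "equivp (\<lambda>u v. u - v \<in> f2.span (S :: 'v::f2_vs set))"
proof (rule equivpI)
  show "reflp (\<lambda>u v. u - v \<in> f2.span S)" by (auto intro!: reflpI f2.span_zero)
  show "symp (\<lambda>u v. u - v \<in> f2.span S)"
    by (rule sympI) (metis f2.span_neg minus_diff_eq)
  show "transp (\<lambda>u v. u - v \<in> f2.span S)"
    by (rule transpI) (metis f2.span_add diff_add_cancel add_diff_eq)
qed

(* The free F_2-vector space on a type is its type of finitely supported functions to bit;
   lin f is the linear extension of f. *)
abbreviation basis :: "'p \<Rightarrow> 'p \<Rightarrow>\<^sub>0 bit" where
  "basis p \<equiv> Poly_Mapping.single p 1"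

definition lin :: "('p \<Rightarrow> 'v::f2_vs) \<Rightarrow> ('p \<Rightarrow>\<^sub>0 bit) \<Rightarrow> 'v" where
  "lin f u = (\<Sum>p\<in>Poly_Mapping.keys u. f p)"

lemma lin_superset:
  assumes "finite S" "Poly_Mapping.keys u \<subseteq> S"
  shows "lin f u = (\<Sum>p\<in>S. f2scale (Poly_Mapping.lookup u p) (f p))"
proof -
  have "lin f u = (\<Sum>p\<in>Poly_Mapping.keys u. f2scale (Poly_Mapping.lookup u p) (f p))"
    unfolding lin_def by (rule sum.cong) (auto simp: f2scale_def in_keys_iff)
  also have "\<dots> = (\<Sum>p\<in>S. f2scale (Poly_Mapping.lookup u p) (f p))"
    by (rule sum.mono_neutral_left) (use assms in \<open>auto simp: f2scale_def in_keys_iff\<close>)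
  finally show ?thesis .
qed

lemma lin_0 [simp]: "lin f 0 = 0"
  by (simp add: lin_def)

lemma lin_basis [simp]: "lin f (basis p) = f p"
  by (simp add: lin_def)

lemma lin_add: "lin f (u + v) = lin f u + lin f v"
proof -
  let ?S = "Poly_Mapping.keys u \<union> Poly_Mapping.keys v"
  have "Poly_Mapping.keys (u + v) \<subseteq> ?S" by (rule keys_add)
  then show ?thesis
    by (simp add: lin_superset[of ?S] lookup_add f2.scale_left_distrib sum.distrib del: add_bit_eq_xor)
qed

lemma lin_diff: "lin f (u - v) = lin f u - lin f v"
  by (simp only: f2_diff lin_add)

lemma additive_lin: "additive (lin f)"
  by standard (rule lin_add)

lemma free_induct [case_names zero basis add]:
  fixes u :: "'p \<Rightarrow>\<^sub>0 bit"
  assumes z: "P 0" and b: "\<And>p. P (basis p)" and a: "\<And>u v. P u \<Longrightarrow> P v \<Longrightarrow> P (u + v)"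
  shows "P u"
proof (induction u rule: update_induct)
  case const
  show ?case by (rule z)
next
  case (update u k c)
  then have "c = 1" by simp
  have "Poly_Mapping.update k c u = u + basis k"
    by (rule poly_mapping_eqI)
      (use update \<open>c = 1\<close> in \<open>auto simp: lookup_update lookup_add lookup_single when_def in_keys_iff\<close>)
  then show ?case using a b update by simp
qed

lemma lin_additive:
  assumes "additive h"
  shows "h (lin f u) = lin (\<lambda>p. h (f p)) u"
  by (induction u rule: free_induct)
    (simp_all add: lin_add additive.add[OF assms] additive.zero[OF assms])

lemma lin_plus_fun: "lin (\<lambda>p. f p + g p) u = lin f u + lin g u"
  by (simp add: lin_def sum.distrib)

lemma lin_zero_fun [simp]: "lin (\<lambda>p. 0) u = 0"
  by (simp add: lin_def)

lemma lin_in_span: "(\<And>p. f p \<in> f2.span S) \<Longrightarrow> lin f u \<in> f2.span S"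
  unfolding lin_def by (rule f2.span_sum)

lemma lin_id: "lin basis u = u"
  by (induction u rule: free_induct) (auto simp: lin_add)

section \<open>Path algebras with relations\<close>

definition verts :: "nat set set" where
  "verts = Pow {0, 1, 2}"

lemma finite_verts [simp]: "finite verts"
  by (simp add: verts_def)

lemma empty_verts [simp]: "{} \<in> verts"
  by (simp add: verts_def)

(* A quiver with vertex set verts, at most one arrow of each label starting at each vertex:
   step a x is the target of the arrow labelled a starting at x, if there is one. A path is thus
   given by its first vertex and its word of labels, multiplied left to right. *)
class quiver =
  fixes step :: "'a \<Rightarrow> nat set \<Rightarrow> nat set option"
  assumes step_verts: "x \<in> verts \<Longrightarrow> step a x = Some y \<Longrightarrow> y \<in> verts"
begin

primrec run :: "'a list \<Rightarrow> nat set \<Rightarrow> nat set option" where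
  "run [] x = Some x"
| "run (a # w) x = Option.bind (step a x) (run w)"

definition is_path :: "nat set \<Rightarrow> 'a list \<Rightarrow> bool" where
  "is_path x w \<longleftrightarrow> x \<in> verts \<and> run w x \<noteq> None"

lemma run_append: "run (w @ v) x = Option.bind (run w x) (run v)"
  by (induction w arbitrary: x) (auto simp: Option.bind_eq_Some_conv split: bind_splits)

lemma run_verts: "x \<in> verts \<Longrightarrow> run w x = Some y \<Longrightarrow> y \<in> verts"
  by (induction w arbitrary: x) (use step_verts in \<open>force split: bind_splits\<close>)+

end

typedef (overloaded) 'a path = "{(x, w :: 'a::quiver list). is_path x w}"
  by (rule exI[of _ "({}, [])"]) (simp add: is_path_def)

definition src :: "'a::quiver path \<Rightarrow> nat set" where
  "src p = fst (Rep_path p)"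

definition word :: "'a::quiver path \<Rightarrow> 'a list" where
  "word p = snd (Rep_path p)"

definition tgt :: "'a::quiver path \<Rightarrow> nat set" where
  "tgt p = the (run (word p) (src p))"

(* Words that are not paths starting at x are sent to 0. *)
definition pth :: "nat set \<Rightarrow> 'a::quiver list \<Rightarrow> 'a path \<Rightarrow>\<^sub>0 bit" where
  "pth x w = (if is_path x w then basis (Abs_path (x, w)) else 0)"

lemma is_path_path: "is_path (src p) (word p)"
  using Rep_path[of p] by (auto simp: src_def word_def)

lemma src_verts: "src p \<in> verts"
  using is_path_path by (auto simp: is_path_def)

lemma pth_path: "pth (src p) (word p) = basis p"
  using is_path_path[of p] by (simp add: pth_def src_def word_def Rep_path_inverse)

lemma src_Abs [simp]: "is_path x w \<Longrightarrow> src (Abs_path (x, w)) = x"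
  and word_Abs [simp]: "is_path x w \<Longrightarrow> word (Abs_path (x, w)) = w"
  and tgt_Abs [simp]: "is_path x w \<Longrightarrow> tgt (Abs_path (x, w)) = the (run w x)"
  by (simp_all add: src_def word_def tgt_def Abs_path_inverse)

lemma pth_eq_0: "\<not> is_path x w \<Longrightarrow> pth x w = 0"
  by (simp add: pth_def)

lemma path_alg_induct [case_names zero pth add]:
  fixes u :: "'a::quiver path \<Rightarrow>\<^sub>0 bit"
  assumes "P 0" "\<And>x w. is_path x w \<Longrightarrow> P (pth x w)" "\<And>u v. P u \<Longrightarrow> P v \<Longrightarrow> P (u + v)"
  shows "P u"
  by (induction u rule: free_induct) (simp_all add: assms(1,3) assms(2)[OF is_path_path] flip: pth_path)

lemma lin_pth:
  assumes "is_path x w"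
  shows "lin f (pth x w) = f (Abs_path (x, w))"
  using assms by (simp add: pth_def)

definition pcomp :: "'a::quiver path \<Rightarrow> 'a path \<Rightarrow> 'a path \<Rightarrow>\<^sub>0 bit" where
  "pcomp p q = (if tgt p = src q then pth (src p) (word p @ word q) else 0)"

definition pmult :: "('a::quiver path \<Rightarrow>\<^sub>0 bit) \<Rightarrow> ('a path \<Rightarrow>\<^sub>0 bit) \<Rightarrow> 'a path \<Rightarrow>\<^sub>0 bit" where
  "pmult u v = lin (\<lambda>p. lin (pcomp p) v) u"

definition pone :: "'a::quiver path \<Rightarrow>\<^sub>0 bit" where
  "pone = (\<Sum>x\<in>verts. pth x [])"

lemma pmult_add_left: "pmult (u + u') v = pmult u v + pmult u' v"
  by (simp add: pmult_def lin_add)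

lemma pmult_add_right: "pmult u (v + v') = pmult u v + pmult u v'"
  by (simp add: pmult_def lin_add lin_plus_fun)

lemma pmult_0_left [simp]: "pmult 0 v = 0"
  by (simp add: pmult_def)

lemma pmult_0_right [simp]: "pmult u 0 = 0"
  by (simp add: pmult_def)

lemma pmult_diff_left: "pmult (u - u') v = pmult u v - pmult u' v"
  by (simp add: f2_diff pmult_add_left)

lemma pmult_diff_right: "pmult u (v - v') = pmult u v - pmult u v'"
  by (simp add: f2_diff pmult_add_right)

lemma pmult_sum_left: "finite S \<Longrightarrow> pmult (sum f S) v = (\<Sum>x\<in>S. pmult (f x) v)"
  by (induction S rule: finite_induct) (simp_all add: pmult_add_left)

lemma pmult_sum_right: "finite S \<Longrightarrow> pmult u (sum f S) = (\<Sum>x\<in>S. pmult u (f x))"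
  by (induction S rule: finite_induct) (simp_all add: pmult_add_right)

lemma pmult_pth:
  "pmult (pth x w) (pth y v) = (if x \<in> verts \<and> run w x = Some y then pth x (w @ v) else 0)"
proof (cases "is_path x w \<and> is_path y v")
  case True
  then show ?thesis
    by (auto simp: pmult_def lin_pth pcomp_def is_path_def)
next
  case False
  then show ?thesis
    by (auto simp: pth_def pmult_def is_path_def run_append dest: run_verts)
qed

lemma pmult_assoc: "pmult (pmult u v) z = pmult u (pmult v z)"
proof (induction u rule: path_alg_induct)
  case (pth x w)
  show ?case
  proof (induction v rule: path_alg_induct)
    case (pth x' w')
    show ?case
    proof (induction z rule: path_alg_induct)
      case (pth x'' w'')
      show ?case
        by (auto simp: pmult_pth run_append dest: run_verts)
    qed (simp_all add: pmult_add_right)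
  qed (simp_all add: pmult_add_left pmult_add_right)
qed (simp_all add: pmult_add_left)

lemma pone_left: "pmult pone u = u"
proof (induction u rule: path_alg_induct)
  case (pth x w)
  then have "x \<in> verts" by (simp add: is_path_def)
  then show ?case
    by (simp add: pone_def pmult_sum_left pmult_pth if_distrib conj_commute cong: if_cong)
qed (simp_all add: pmult_add_right)

lemma pone_right: "pmult u pone = u"
proof (induction u rule: path_alg_induct)
  case (pth x w)
  then obtain y where y: "x \<in> verts" "run w x = Some y" by (auto simp: is_path_def)
  then have "y \<in> verts" by (auto dest: run_verts)
  then show ?case
    using y by (simp add: pone_def pmult_sum_right pmult_pth sum.delta)
qed (simp_all add: pmult_add_left)

(* A relation is a finite formal sum of paths, to be set to 0. It is a multiset since a path
   occurring twice cancels: the relation that a loop U commutes with itself must be void and not UU = 0. *)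
class quiver_rel = quiver +
  fixes rels :: "(nat set \<times> 'a list) multiset set"
  assumes rels_path: "\<rho> \<in> rels \<Longrightarrow> (x, w) \<in># \<rho> \<Longrightarrow> is_path x w"

definition rel_elem :: "(nat set \<times> 'a::quiver list) multiset \<Rightarrow> 'a path \<Rightarrow>\<^sub>0 bit" where
  "rel_elem \<rho> = (\<Sum>(x, w)\<in>#\<rho>. pth x w)"

(* The two-sided ideal generated by the relations; the path algebra is unital. *)
definition ideal :: "('a::quiver_rel path \<Rightarrow>\<^sub>0 bit) set" where
  "ideal = f2.span {pmult (pmult u (rel_elem \<rho>)) v | u v \<rho>. \<rho> \<in> rels}"

lemma ideal_mult_left: "r \<in> ideal \<Longrightarrow> pmult u r \<in> ideal"
  unfolding ideal_def
proof (induction rule: f2_span_induct)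
  case (base s)
  then obtain a b \<rho> where "s = pmult (pmult a (rel_elem \<rho>)) b" "\<rho> \<in> rels" by auto
  then have "pmult u s = pmult (pmult (pmult u a) (rel_elem \<rho>)) b" by (simp add: pmult_assoc)
  then show ?case using \<open>\<rho> \<in> rels\<close> by (intro f2.span_base) blast
qed (auto simp: pmult_add_right intro: f2.span_add f2.span_zero)

lemma ideal_mult_right: "r \<in> ideal \<Longrightarrow> pmult r u \<in> ideal"
  unfolding ideal_def
proof (induction rule: f2_span_induct)
  case (base s)
  then obtain a b \<rho> where "s = pmult (pmult a (rel_elem \<rho>)) b" "\<rho> \<in> rels" by auto
  then have "pmult s u = pmult (pmult a (rel_elem \<rho>)) (pmult b u)" by (simp add: pmult_assoc)
  then show ?case using \<open>\<rho> \<in> rels\<close> by (intro f2.span_base) blast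
qed (auto simp: pmult_add_left intro: f2.span_add f2.span_zero)

lemma ideal_add: "r \<in> ideal \<Longrightarrow> s \<in> ideal \<Longrightarrow> r + s \<in> ideal"
  and ideal_0: "0 \<in> ideal"
  unfolding ideal_def by (auto intro: f2.span_add f2.span_zero)

lemma rel_elem_ideal: "\<rho> \<in> rels \<Longrightarrow> rel_elem \<rho> \<in> ideal"
  unfolding ideal_def
  by (rule f2.span_base) (metis (mono_tags, lifting) mem_Collect_eq pone_left pone_right)

quotient_type (overloaded) 'a quiver_alg =
  "'a::quiver_rel path \<Rightarrow>\<^sub>0 bit" / "\<lambda>u v. u - v \<in> ideal"
  unfolding ideal_def by (rule equivp_span)

class f2_alg = f2_vs + ring + monoid_mult

instantiation quiver_alg :: (quiver_rel) f2_alg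
begin

lift_definition zero_quiver_alg :: "'a quiver_alg" is 0 .
lift_definition one_quiver_alg :: "'a quiver_alg" is pone .
lift_definition plus_quiver_alg :: "'a quiver_alg \<Rightarrow> 'a quiver_alg \<Rightarrow> 'a quiver_alg" is "(+)"
  by (metis (no_types, opaque_lifting) add_diff_add ideal_add)
lift_definition minus_quiver_alg :: "'a quiver_alg \<Rightarrow> 'a quiver_alg \<Rightarrow> 'a quiver_alg" is "(-)"
  unfolding f2_diff by (metis (no_types, opaque_lifting) add.left_commute add.assoc ideal_add)
lift_definition uminus_quiver_alg :: "'a quiver_alg \<Rightarrow> 'a quiver_alg" is uminus
  by simp
lift_definition times_quiver_alg :: "'a quiver_alg \<Rightarrow> 'a quiver_alg \<Rightarrow> 'a quiver_alg" is pmult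
proof -
  fix u u' v v' :: "'a path \<Rightarrow>\<^sub>0 bit"
  assume "u - u' \<in> ideal" "v - v' \<in> ideal"
  then have "pmult (u - u') v + pmult u' (v - v') \<in> ideal"
    by (intro ideal_add ideal_mult_left ideal_mult_right)
  then show "pmult u v - pmult u' v' \<in> ideal"
    by (simp add: f2_diff pmult_add_left pmult_add_right add.assoc)
qed

instance
proof
  fix a b c :: "'a quiver_alg"
  show "a + a = 0" by transfer (simp add: add_self ideal_0)
  show "a + b + c = a + (b + c)" "a + b = b + a" "0 + a = a" "- a + a = 0" "a - b = a + - b"
    by (transfer; simp add: ideal_0 add_ac add_self f2_diff)+
  show "a * b * c = a * (b * c)" "1 * a = a" "a * 1 = a"
    by (transfer; simp add: ideal_0 pmult_assoc pone_left pone_right)+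
  show "(a + b) * c = a * c + b * c" "a * (b + c) = a * b + a * c"
    by (transfer; simp add: ideal_0 pmult_add_left pmult_add_right)+
qed

end

lift_definition path_elem :: "nat set \<Rightarrow> 'a::quiver_rel list \<Rightarrow> 'a quiver_alg" is pth .

(* rv is the reflection of vertices; rlab and olab are the actions on labels of the reflection
   automorphism (alg_R) and of the arrow-reversing anti-automorphism (alg_o). *)
definition rv :: "nat set \<Rightarrow> nat set" where
  "rv x = (\<lambda>i. 2 - i) ` x"

lemma rv_verts: "x \<in> verts \<Longrightarrow> rv x \<in> verts"
  by (auto simp: rv_def verts_def)

class quiver_inv = quiver +
  fixes rlab :: "'a \<Rightarrow> 'a" and olab :: "'a \<Rightarrow> 'a"
  assumes step_rlab: "x \<in> verts \<Longrightarrow> step a x = Some y \<Longrightarrow> step (rlab a) (rv x) = Some (rv y)"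
    and step_olab: "x \<in> verts \<Longrightarrow> step a x = Some y \<Longrightarrow> step (olab a) y = Some x"
begin

lemma run_rlab:
  "x \<in> verts \<Longrightarrow> run w x = Some y \<Longrightarrow> run (map rlab w) (rv x) = Some (rv y)"
proof (induction w arbitrary: x)
  case (Cons a w)
  then obtain z where "step a x = Some z" "run w z = Some y" by (auto split: bind_splits)
  then show ?case using Cons step_verts step_rlab by auto
qed simp

lemma run_olab:
  "x \<in> verts \<Longrightarrow> run w x = Some y \<Longrightarrow> run (rev (map olab w)) y = Some x"
proof (induction w arbitrary: x)
  case (Cons a w)
  then obtain z where "step a x = Some z" "run w z = Some y" by (auto split: bind_splits)
  then show ?case using Cons step_verts[of x a z] step_olab[of x a z] by (simp add: run_append)
qed simp

lemma is_path_rlab: "is_path x w \<Longrightarrow> is_path (rv x) (map rlab w)"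
  using run_rlab rv_verts by (auto simp: is_path_def)

lemma is_path_olab: "is_path x w \<Longrightarrow> is_path (the (run w x)) (rev (map olab w))"
  using run_olab run_verts by (auto simp: is_path_def)

end

class quiver_sym = quiver_rel + quiver_inv +
  assumes rels_rlab: "\<rho> \<in> rels \<Longrightarrow> image_mset (\<lambda>(x, w). (rv x, map rlab w)) \<rho> \<in> rels"
    and rels_olab: "\<rho> \<in> rels \<Longrightarrow> image_mset (\<lambda>(x, w). (the (run w x), rev (map olab w))) \<rho> \<in> rels"

definition path_R :: "('a::quiver_sym path \<Rightarrow>\<^sub>0 bit) \<Rightarrow> 'a path \<Rightarrow>\<^sub>0 bit" where
  "path_R = lin (\<lambda>p. pth (rv (src p)) (map rlab (word p)))"

definition path_o :: "('a::quiver_sym path \<Rightarrow>\<^sub>0 bit) \<Rightarrow> 'a path \<Rightarrow>\<^sub>0 bit" where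
  "path_o = lin (\<lambda>p. pth (tgt p) (rev (map olab (word p))))"

lemma path_R_add: "path_R (u + v) = path_R u + path_R v"
  and path_o_add: "path_o (u + v) = path_o u + path_o v"
  and path_R_0 [simp]: "path_R 0 = 0"
  and path_o_0 [simp]: "path_o 0 = 0"
  by (simp_all add: path_R_def path_o_def lin_add)

lemma path_R_pth: "is_path x w \<Longrightarrow> path_R (pth x w) = pth (rv x) (map rlab w)"
  and path_o_pth: "is_path x w \<Longrightarrow> path_o (pth x w) = pth (the (run w x)) (rev (map olab w))"
  by (simp_all add: path_R_def path_o_def lin_pth)

lemma path_R_mult: "path_R (pmult u v) = pmult (path_R u) (path_R v)"
proof (induction u rule: path_alg_induct)
  case u: (pth x w)
  show ?case
  proof (induction v rule: path_alg_induct)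
    case v: (pth y w')
    show ?case
    proof (cases "run w x = Some y")
      case True
      then show ?thesis
        using u v by (auto simp: path_R_pth pmult_pth is_path_def run_append rv_verts run_rlab)
    next
      case False
      then obtain z where z: "run w x = Some z" "z \<in> verts" "z \<noteq> y"
        using u by (auto simp: is_path_def dest: run_verts)
      have "rv z \<noteq> rv y"
      proof
        assume "rv z = rv y"
        then have "rv (rv z) = rv (rv y)" by simp
        moreover have "rv (rv t) = t" if "t \<in> verts" for t
          using that by (force simp: rv_def verts_def image_image)
        ultimately show False using z v by (auto simp: is_path_def)
      qed
      then show ?thesis
        using u v z by (auto simp: path_R_pth pmult_pth is_path_def run_rlab)
    qed
  qed (simp_all add: pmult_add_right path_R_add)
qed (simp_all add: pmult_add_left path_R_add)

lemma path_o_mult: "path_o (pmult u v) = pmult (path_o v) (path_o u)"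
proof (induction u rule: path_alg_induct)
  case u: (pth x w)
  then obtain z where z: "x \<in> verts" "run w x = Some z" "z \<in> verts"
    by (auto simp: is_path_def dest: run_verts)
  show ?case
  proof (induction v rule: path_alg_induct)
    case v: (pth y w')
    then obtain t where t: "y \<in> verts" "run w' y = Some t" "t \<in> verts"
      by (auto simp: is_path_def dest: run_verts)
    show ?case
      using u v z t
      by (auto simp: path_o_pth pmult_pth is_path_def run_append run_olab)
  qed (simp_all add: pmult_add_left pmult_add_right path_o_add)
qed (simp_all add: pmult_add_left pmult_add_right path_o_add)

lemma path_R_rel:
  assumes "\<rho> \<in> rels"
  shows "path_R (rel_elem \<rho>) = rel_elem (image_mset (\<lambda>(x, w). (rv x, map rlab w)) \<rho>)"
proof -
  have "(\<And>x w. (x, w) \<in># \<sigma> \<Longrightarrow> is_path x w) \<Longrightarrow>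
      path_R (rel_elem \<sigma>) = rel_elem (image_mset (\<lambda>(x, w). (rv x, map rlab w)) \<sigma>)" for \<sigma>
    by (induction \<sigma>) (auto simp: rel_elem_def path_R_add path_R_pth)
  then show ?thesis using rels_path[OF assms] by blast
qed

lemma path_o_rel:
  assumes "\<rho> \<in> rels"
  shows "path_o (rel_elem \<rho>) =
    rel_elem (image_mset (\<lambda>(x, w). (the (run w x), rev (map olab w))) \<rho>)"
proof -
  have "(\<And>x w. (x, w) \<in># \<sigma> \<Longrightarrow> is_path x w) \<Longrightarrow> path_o (rel_elem \<sigma>) =
      rel_elem (image_mset (\<lambda>(x, w). (the (run w x), rev (map olab w))) \<sigma>)" for \<sigma>
    by (induction \<sigma>) (auto simp: rel_elem_def path_o_add path_o_pth)
  then show ?thesis using rels_path[OF assms] by blast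
qed

lemma path_R_ideal: "r \<in> ideal \<Longrightarrow> path_R r \<in> ideal"
proof (subst (asm) ideal_def, induction rule: f2_span_induct)
  case (base s)
  then obtain u v \<rho> where s: "s = pmult (pmult u (rel_elem \<rho>)) v" "\<rho> \<in> rels" by auto
  then have "path_R (rel_elem \<rho>) \<in> ideal"
    by (simp add: path_R_rel rel_elem_ideal rels_rlab)
  then show ?case
    by (simp add: s path_R_mult ideal_mult_left ideal_mult_right)
qed (simp_all add: path_R_add ideal_0 ideal_add)

lemma path_o_ideal: "r \<in> ideal \<Longrightarrow> path_o r \<in> ideal"
proof (subst (asm) ideal_def, induction rule: f2_span_induct)
  case (base s)
  then obtain u v \<rho> where s: "s = pmult (pmult u (rel_elem \<rho>)) v" "\<rho> \<in> rels" by auto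
  then have "path_o (rel_elem \<rho>) \<in> ideal"
    by (simp add: path_o_rel rel_elem_ideal rels_olab)
  then show ?case
    by (simp add: s path_o_mult ideal_mult_left ideal_mult_right)
qed (simp_all add: path_o_add ideal_0 ideal_add)

lift_definition alg_R :: "'a::quiver_sym quiver_alg \<Rightarrow> 'a quiver_alg" is path_R
  by (simp add: f2_diff path_R_ideal flip: path_R_add)

(* Anti-multiplicative, see alg_o_mult below; as a map to the opposite algebra it is Op o alg_o. *)
lift_definition alg_o :: "'a::quiver_sym quiver_alg \<Rightarrow> 'a quiver_alg" is path_o
  by (simp add: f2_diff path_o_ideal flip: path_o_add)

lemma alg_R_add: "alg_R (a + b) = alg_R a + alg_R b"
  and alg_R_mult: "alg_R (a * b) = alg_R a * alg_R b"
  by (transfer; simp add: path_R_add path_R_mult ideal_0)+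

lemma alg_o_add: "alg_o (a + b) = alg_o a + alg_o b"
  and alg_o_mult: "alg_o (a * b) = alg_o b * alg_o a"
  by (transfer; simp add: path_o_add path_o_mult ideal_0)+

lemma alg_R_path_elem: "is_path x w \<Longrightarrow> alg_R (path_elem x w) = path_elem (rv x) (map rlab w)"
  by transfer (simp add: path_R_pth ideal_0)

lemma alg_o_path_elem:
  "is_path x w \<Longrightarrow> alg_o (path_elem x w) = path_elem (the (run w x)) (rev (map olab w))"
  by transfer (simp add: path_o_pth ideal_0)

section \<open>Tensor products\<close>

definition tensor_rels :: "(('a::f2_vs \<times> 'b::f2_vs) \<Rightarrow>\<^sub>0 bit) set" where
  "tensor_rels =
     {basis (a + a', b) - basis (a, b) - basis (a', b) | a a' b. True} \<union>
     {basis (a, b + b') - basis (a, b) - basis (a, b') | a b b'. True}"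

lemma tensor_relsI:
  "basis (a + a', b) - basis (a, b) - basis (a', b) \<in> tensor_rels"
  "basis (a, b + b') - basis (a, b) - basis (a, b') \<in> tensor_rels"
  unfolding tensor_rels_def by blast+

quotient_type (overloaded) ('a, 'b) tensor =
  "('a::f2_vs \<times> 'b::f2_vs) \<Rightarrow>\<^sub>0 bit" / "\<lambda>u v. u - v \<in> f2.span tensor_rels"
  by (rule equivp_span)

lift_definition tens :: "'a::f2_vs \<Rightarrow> 'b::f2_vs \<Rightarrow> ('a, 'b) tensor"  (infixl "\<otimes>" 72)
  is "\<lambda>a b. basis (a, b)" .

lemma span_add_cong:
  "u - u' \<in> f2.span S \<Longrightarrow> v - v' \<in> f2.span S \<Longrightarrow> (u + v) - (u' + v') \<in> f2.span S"
  "u - u' \<in> f2.span S \<Longrightarrow> v - v' \<in> f2.span S \<Longrightarrow> (u - v) - (u' - v') \<in> f2.span S"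
  using f2.span_add[of "u - u'" S "v - v'"] f2.span_diff[of "u - u'" S "v - v'"]
  by (simp_all add: algebra_simps)

instantiation tensor :: (f2_vs, f2_vs) f2_vs
begin

lift_definition zero_tensor :: "('a, 'b) tensor" is 0 .
lift_definition plus_tensor :: "('a, 'b) tensor \<Rightarrow> ('a, 'b) tensor \<Rightarrow> ('a, 'b) tensor" is "(+)"
  by (rule span_add_cong)
lift_definition minus_tensor :: "('a, 'b) tensor \<Rightarrow> ('a, 'b) tensor \<Rightarrow> ('a, 'b) tensor" is "(-)"
  by (rule span_add_cong)
lift_definition uminus_tensor :: "('a, 'b) tensor \<Rightarrow> ('a, 'b) tensor" is uminus
  by simp

instance
proof
  fix a b c :: "('a, 'b) tensor"
  show "a + a = 0" "a + b + c = a + (b + c)" "a + b = b + a" "0 + a = a" "- a + a = 0"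
    "a - b = a + - b"
    by (transfer; simp add: f2.span_zero add_ac add_self f2_diff)+
qed

end

lemma tens_add_left: "(a + a') \<otimes> b = a \<otimes> b + a' \<otimes> b"
  by transfer (rule f2.span_base, unfold diff_diff_eq[symmetric], rule tensor_relsI)

lemma tens_add_right: "a \<otimes> (b + b') = a \<otimes> b + a \<otimes> b'"
  by transfer (rule f2.span_base, unfold diff_diff_eq[symmetric], rule tensor_relsI)

lemma tens_zero_left [simp]: "0 \<otimes> b = 0"
  using tens_add_left[of 0 0 b] by simp

lemma tens_zero_right [simp]: "a \<otimes> 0 = 0"
  using tens_add_right[of a 0 0] by simp

lemma tensor_induct [case_names tens add]:
  assumes "\<And>a b. P (a \<otimes> b)" "\<And>s t. P s \<Longrightarrow> P t \<Longrightarrow> P (s + t)"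
  shows "P t"
proof -
  have "P (abs_tensor u)" for u
  proof (induction u rule: free_induct)
    case zero
    then show ?case using assms(1)[of 0 0] by (simp add: zero_tensor.abs_eq)
  next
    case (basis p)
    then show ?case using assms(1)[of "fst p" "snd p"] by (simp add: tens.abs_eq)
  next
    case (add u v)
    then show ?case using assms(2)[of "abs_tensor u" "abs_tensor v"] by (simp add: plus_tensor.abs_eq)
  qed
  from this[of "rep_tensor t"] show ?thesis
    by (simp add: Quotient3_abs_rep[OF Quotient3_tensor])
qed

definition tensor_mult ::
  "(('a::f2_alg \<times> 'b::f2_alg) \<Rightarrow>\<^sub>0 bit) \<Rightarrow> (('a \<times> 'b) \<Rightarrow>\<^sub>0 bit) \<Rightarrow> ('a \<times> 'b) \<Rightarrow>\<^sub>0 bit" where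
  "tensor_mult u v = lin (\<lambda>p. lin (\<lambda>q. basis (fst p * fst q, snd p * snd q)) v) u"

lemma tensor_mult_add_left: "tensor_mult (u + u') v = tensor_mult u v + tensor_mult u' v"
  by (simp add: tensor_mult_def lin_add)

lemma tensor_mult_add_right: "tensor_mult u (v + v') = tensor_mult u v + tensor_mult u v'"
  by (simp add: tensor_mult_def lin_add lin_plus_fun)

lemma tensor_mult_basis: "tensor_mult (basis (a, a')) (basis (b, b')) = basis (a * b, a' * b')"
  by (simp add: tensor_mult_def)

lemma tensor_mult_0 [simp]: "tensor_mult 0 v = 0" "tensor_mult u 0 = 0"
  by (simp_all add: tensor_mult_def)

lemma tensor_mult_span_left:
  assumes "u \<in> f2.span tensor_rels"
  shows "tensor_mult u v \<in> f2.span tensor_rels"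
  using assms
proof (induction rule: f2_span_induct)
  case (base s)
  show ?case
  proof (induction v rule: free_induct)
    case (basis p)
    obtain c d where p: "p = (c, d)" by force
    from base consider
        a a' b where "s = basis (a + a', b) - basis (a, b) - basis (a', b)"
      | a b b' where "s = basis (a, b + b') - basis (a, b) - basis (a, b')"
      unfolding tensor_rels_def by (elim UnE CollectE exE conjE) simp_all
    then have "tensor_mult s (basis p) \<in> tensor_rels"
    proof cases
      case 1
      then show ?thesis
        using tensor_relsI(1)[of "a * c" "a' * c" "b * d"]
        by (simp add: p f2_diff tensor_mult_add_left tensor_mult_basis distrib_left distrib_right)
    next
      case 2
      then show ?thesis
        using tensor_relsI(2)[of "a * c" "b * d" "b' * d"]
        by (simp add: p f2_diff tensor_mult_add_left tensor_mult_basis distrib_left distrib_right)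
    qed
    then show ?case by (rule f2.span_base)
  qed (simp_all add: tensor_mult_add_right f2.span_add f2.span_zero)
qed (simp_all add: tensor_mult_add_left f2.span_add f2.span_zero)

lemma tensor_mult_span_right:
  assumes "v \<in> f2.span tensor_rels"
  shows "tensor_mult u v \<in> f2.span tensor_rels"
  using assms
proof (induction rule: f2_span_induct)
  case (base s)
  show ?case
  proof (induction u rule: free_induct)
    case (basis p)
    obtain c d where p: "p = (c, d)" by force
    from base consider
        a a' b where "s = basis (a + a', b) - basis (a, b) - basis (a', b)"
      | a b b' where "s = basis (a, b + b') - basis (a, b) - basis (a, b')"
      unfolding tensor_rels_def by (elim UnE CollectE exE conjE) simp_all
    then have "tensor_mult (basis p) s \<in> tensor_rels"
    proof cases
      case 1
      then show ?thesis
        using tensor_relsI(1)[of "c * a" "c * a'" "d * b"]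
        by (simp add: p f2_diff tensor_mult_add_right tensor_mult_basis distrib_left distrib_right)
    next
      case 2
      then show ?thesis
        using tensor_relsI(2)[of "c * a" "d * b" "d * b'"]
        by (simp add: p f2_diff tensor_mult_add_right tensor_mult_basis distrib_left distrib_right)
    qed
    then show ?case by (rule f2.span_base)
  qed (simp_all add: tensor_mult_add_left f2.span_add f2.span_zero)
qed (simp_all add: tensor_mult_add_right f2.span_add f2.span_zero)

instantiation tensor :: (f2_alg, f2_alg) f2_alg
begin

lift_definition one_tensor :: "('a, 'b) tensor" is "basis (1, 1)" .
lift_definition times_tensor :: "('a, 'b) tensor \<Rightarrow> ('a, 'b) tensor \<Rightarrow> ('a, 'b) tensor"
  is tensor_mult
proof -
  fix u u' v v' :: "('a \<times> 'b) \<Rightarrow>\<^sub>0 bit"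
  assume "u - u' \<in> f2.span tensor_rels" "v - v' \<in> f2.span tensor_rels"
  then have "tensor_mult (u - u') v + tensor_mult u' (v - v') \<in> f2.span tensor_rels"
    by (intro f2.span_add tensor_mult_span_left tensor_mult_span_right)
  then show "tensor_mult u v - tensor_mult u' v' \<in> f2.span tensor_rels"
    by (simp add: f2_diff tensor_mult_add_left tensor_mult_add_right add.assoc)
qed

lemma tens_mult: "(a \<otimes> a') * (b \<otimes> b') = (a * b) \<otimes> (a' * b')"
  for a b :: 'a and a' b' :: 'b
  by transfer (simp add: tensor_mult_basis f2.span_zero)

instance
proof
  fix a b c :: "('a, 'b) tensor"
  show 1: "(a + b) * c = a * c + b * c" for a b c :: "('a, 'b) tensor"
    by transfer (simp add: tensor_mult_add_left f2.span_zero)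
  show 2: "a * (b + c) = a * b + a * c" for a b c :: "('a, 'b) tensor"
    by transfer (simp add: tensor_mult_add_right f2.span_zero)
  have one: "(1 :: ('a, 'b) tensor) = 1 \<otimes> 1" by transfer (simp add: f2.span_zero)
  show "1 * a = a" "a * 1 = a"
    by (induction a rule: tensor_induct; simp add: 1 2 one tens_mult)+
  show "a * b * c = a * (b * c)"
  proof (induction a rule: tensor_induct)
    case a: (tens a a')
    show ?case
    proof (induction b rule: tensor_induct)
      case b: (tens b b')
      show ?case
        by (induction c rule: tensor_induct) (simp_all add: 2 tens_mult mult.assoc)
    qed (simp_all add: 1 2)
  qed (simp_all add: 1)
qed

end

(* Independent of the chosen representative when f and g are additive, see tensor_map_abs. *)
definition tensor_map ::
  "('a::f2_vs \<Rightarrow> 'c::f2_vs) \<Rightarrow> ('b::f2_vs \<Rightarrow> 'd::f2_vs) \<Rightarrow> ('a, 'b) tensor \<Rightarrow> ('c, 'd) tensor" where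
  "tensor_map f g t = lin (\<lambda>(a, b). f a \<otimes> g b) (rep_tensor t)"

lemma tensor_map_abs:
  assumes f: "additive f" and g: "additive g"
  shows "tensor_map f g (abs_tensor u) = lin (\<lambda>(a, b). f a \<otimes> g b) u"
proof -
  let ?h = "lin (\<lambda>(a, b). f a \<otimes> g b)"
  have "?h s = 0" if "s \<in> f2.span tensor_rels" for s
    using that
    by (induction rule: f2_span_induct)
      (auto simp: tensor_rels_def lin_diff lin_add additive.add[OF f] additive.add[OF g]
        tens_add_left tens_add_right)
  moreover have "rep_tensor (abs_tensor u) - u \<in> f2.span tensor_rels"
    by (rule Quotient3_rep_abs[OF Quotient3_tensor]) (simp add: f2.span_zero)
  ultimately have "?h (rep_tensor (abs_tensor u) - u) = 0" by blast
  then show ?thesis by (simp add: tensor_map_def lin_diff)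
qed

lemma tensor_map_tens:
  assumes "additive f" "additive g"
  shows "tensor_map f g (a \<otimes> b) = f a \<otimes> g b"
  using tensor_map_abs[OF assms, of "basis (a, b)"] by (simp add: tens.abs_eq)

lemma tensor_map_add:
  assumes "additive f" "additive g"
  shows "tensor_map f g (s + t) = tensor_map f g s + tensor_map f g t"
proof -
  obtain u v where "s = abs_tensor u" "t = abs_tensor v"
    using Quotient3_abs_rep[OF Quotient3_tensor] by metis
  then show ?thesis
    by (simp add: tensor_map_abs[OF assms] plus_tensor.abs_eq lin_add)
qed

datatype 'a op = Op (unop: 'a)

instantiation op :: (f2_alg) f2_alg
begin

definition "0 = Op 0"
definition "1 = Op 1"
definition "a + b = Op (unop a + unop b)"
definition "a - b = Op (unop a - unop b)"
definition "- a = Op (- unop a)"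
definition "a * b = Op (unop b * unop a)"

instance
  by standard
    (simp_all add: zero_op_def one_op_def plus_op_def minus_op_def uminus_op_def times_op_def
      add_self algebra_simps f2_diff)

end

class idem_alg = f2_alg +
  fixes idem :: "nat set \<Rightarrow> 'a"

instantiation quiver_alg :: (quiver_rel) idem_alg
begin
definition "idem x = path_elem x []"
instance ..
end

class idem2_alg = f2_alg +
  fixes idem2 :: "nat set \<times> nat set \<Rightarrow> 'a"

instantiation tensor :: (idem_alg, idem_alg) idem2_alg
begin
definition "idem2 e = idem (fst e) \<otimes> idem (snd e)"
instance ..
end

instantiation op :: (idem2_alg) idem2_alg
begin
definition "idem2 e = Op (idem2 e)"
instance ..
end

(* Basis elements of a left I(2) (x) I(2)-module, with the pair of idempotents fixing each of them. *)
class idem_basis =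
  fixes idems :: "'a \<Rightarrow> nat set \<times> nat set"

definition idem_act :: "nat set \<times> nat set \<Rightarrow> ('g::idem_basis \<Rightarrow>\<^sub>0 bit) \<Rightarrow> 'g \<Rightarrow>\<^sub>0 bit" where
  "idem_act e = lin (\<lambda>g. if idems g = e then basis g else 0)"

(* Tensor product over I(2) (x) I(2) of an algebra with the module freely spanned by the basis type.
   The idempotents idem2 (x, y) span I(2) (x) I(2), so it is enough to balance over these. *)
definition dtensor_rels :: "(('a::idem2_alg \<times> ('g::idem_basis \<Rightarrow>\<^sub>0 bit)) \<Rightarrow>\<^sub>0 bit) set" where
  "dtensor_rels = tensor_rels \<union>
     {basis (a * idem2 e, u) - basis (a, idem_act e u) | a e u. e \<in> verts \<times> verts}"

lemma dtensor_relsI: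
  "basis (a + a', u) - basis (a, u) - basis (a', u) \<in> dtensor_rels"
  "basis (a, u + u') - basis (a, u) - basis (a, u') \<in> dtensor_rels"
  "e \<in> verts \<times> verts \<Longrightarrow> basis (a * idem2 e, u) - basis (a, idem_act e u) \<in> dtensor_rels"
  unfolding dtensor_rels_def using tensor_relsI by blast+

quotient_type (overloaded) ('a, 'g) dtensor =
  "('a::idem2_alg \<times> ('g::idem_basis \<Rightarrow>\<^sub>0 bit)) \<Rightarrow>\<^sub>0 bit" / "\<lambda>u v. u - v \<in> f2.span dtensor_rels"
  by (rule equivp_span)

lift_definition dtens :: "'a::idem2_alg \<Rightarrow> ('g::idem_basis \<Rightarrow>\<^sub>0 bit) \<Rightarrow> ('a, 'g) dtensor"
  (infixl "\<otimes>\<^sub>I" 72)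
  is "\<lambda>a u. basis (a, u)" .

instantiation dtensor :: (idem2_alg, idem_basis) f2_vs
begin

lift_definition zero_dtensor :: "('a, 'b) dtensor" is 0 .
lift_definition plus_dtensor :: "('a, 'b) dtensor \<Rightarrow> ('a, 'b) dtensor \<Rightarrow> ('a, 'b) dtensor" is "(+)"
  by (rule span_add_cong)
lift_definition minus_dtensor :: "('a, 'b) dtensor \<Rightarrow> ('a, 'b) dtensor \<Rightarrow> ('a, 'b) dtensor" is "(-)"
  by (rule span_add_cong)
lift_definition uminus_dtensor :: "('a, 'b) dtensor \<Rightarrow> ('a, 'b) dtensor" is uminus
  by simp

instance
proof
  fix a b c :: "('a, 'b) dtensor"
  show "a + a = 0" "a + b + c = a + (b + c)" "a + b = b + a" "0 + a = a" "- a + a = 0"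
    "a - b = a + - b"
    by (transfer; simp add: f2.span_zero add_ac add_self f2_diff)+
qed

end

lemma dtens_add_left: "(a + a') \<otimes>\<^sub>I u = a \<otimes>\<^sub>I u + a' \<otimes>\<^sub>I u"
  by transfer (rule f2.span_base, unfold diff_diff_eq[symmetric], rule dtensor_relsI)

lemma dtens_add_right: "a \<otimes>\<^sub>I (u + u') = a \<otimes>\<^sub>I u + a \<otimes>\<^sub>I u'"
  by transfer (rule f2.span_base, unfold diff_diff_eq[symmetric], rule dtensor_relsI)

lemma dtens_balanced:
  "e \<in> verts \<times> verts \<Longrightarrow> (a * idem2 e) \<otimes>\<^sub>I u = a \<otimes>\<^sub>I idem_act e u"
  by transfer (rule f2.span_base, rule dtensor_relsI)

lemma dtens_zero_left [simp]: "0 \<otimes>\<^sub>I u = 0"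
  using dtens_add_left[of 0 0 u] by simp

lemma dtens_zero_right [simp]: "a \<otimes>\<^sub>I 0 = 0"
  using dtens_add_right[of a 0 0] by simp

(* Independent of the chosen representative when f and h are additive and compatible with the
   idempotents up to a permutation of these, see dtensor_map_abs. *)
definition dtensor_map ::
  "('a::idem2_alg \<Rightarrow> 'b::idem2_alg) \<Rightarrow> (('g::idem_basis \<Rightarrow>\<^sub>0 bit) \<Rightarrow> ('h::idem_basis \<Rightarrow>\<^sub>0 bit)) \<Rightarrow>
    ('a, 'g) dtensor \<Rightarrow> ('b, 'h) dtensor" where
  "dtensor_map f h t = lin (\<lambda>(a, u). f a \<otimes>\<^sub>I h u) (rep_dtensor t)"

definition idem_compat ::
  "('a::idem2_alg \<Rightarrow> 'b::idem2_alg) \<Rightarrow> (('g::idem_basis \<Rightarrow>\<^sub>0 bit) \<Rightarrow> ('h::idem_basis \<Rightarrow>\<^sub>0 bit)) \<Rightarrow> bool" where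
  "idem_compat f h \<longleftrightarrow> (\<exists>\<sigma>. \<forall>e\<in>verts \<times> verts. \<sigma> e \<in> verts \<times> verts \<and>
     (\<forall>a. f (a * idem2 e) = f a * idem2 (\<sigma> e)) \<and> (\<forall>u. h (idem_act e u) = idem_act (\<sigma> e) (h u)))"

lemma dtensor_map_abs:
  assumes f: "additive f" and h: "additive h" and c: "idem_compat f h"
  shows "dtensor_map f h (abs_dtensor w) = lin (\<lambda>(a, u). f a \<otimes>\<^sub>I h u) w"
proof -
  let ?h = "lin (\<lambda>(a, u). f a \<otimes>\<^sub>I h u)"
  have bal: "f (a * idem2 e) \<otimes>\<^sub>I h u = f a \<otimes>\<^sub>I h (idem_act e u)" if "e \<in> verts \<times> verts" for a e u
    using c that dtens_balanced unfolding idem_compat_def by metis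
  have "?h s = 0" if "s \<in> f2.span dtensor_rels" for s
    using that
    by (induction rule: f2_span_induct)
      (auto simp: dtensor_rels_def tensor_rels_def lin_diff lin_add additive.add[OF f]
        additive.add[OF h] dtens_add_left dtens_add_right bal)
  moreover have "rep_dtensor (abs_dtensor w) - w \<in> f2.span dtensor_rels"
    by (rule Quotient3_rep_abs[OF Quotient3_dtensor]) (simp add: f2.span_zero)
  ultimately have "?h (rep_dtensor (abs_dtensor w) - w) = 0" by blast
  then show ?thesis by (simp add: dtensor_map_def lin_diff)
qed

lemma dtensor_map_dtens:
  assumes "additive f" "additive h" "idem_compat f h"
  shows "dtensor_map f h (a \<otimes>\<^sub>I u) = f a \<otimes>\<^sub>I h u"
  using dtensor_map_abs[OF assms, of "basis (a, u)"] by (simp add: dtens.abs_eq)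

lemma dtensor_map_add:
  assumes "additive f" "additive h" "idem_compat f h"
  shows "dtensor_map f h (s + t) = dtensor_map f h s + dtensor_map f h t"
proof -
  obtain u v where "s = abs_dtensor u" "t = abs_dtensor v"
    using Quotient3_abs_rep[OF Quotient3_dtensor] by metis
  then show ?thesis
    by (simp add: dtensor_map_abs[OF assms] plus_dtensor.abs_eq lin_add)
qed

section \<open>The algebras B(2) and B^!(2)\<close>

definition r_step :: "nat \<Rightarrow> nat set \<Rightarrow> nat set option" where
  "r_step i x = (if i \<in> {1, 2} \<and> x \<inter> {i - 1, i} = {i - 1} then Some (x - {i - 1} \<union> {i}) else None)"

definition l_step :: "nat \<Rightarrow> nat set \<Rightarrow> nat set option" where
  "l_step i x = (if i \<in> {1, 2} \<and> x \<inter> {i - 1, i} = {i} then Some (x - {i} \<union> {i - 1}) else None)"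

definition loop_step :: "nat \<Rightarrow> nat set \<Rightarrow> nat set option" where
  "loop_step i x = (if i \<in> {1, 2} then Some x else None)"

lemma step_Some_iff:
  "r_step i x = Some y \<longleftrightarrow> (i = 1 \<or> i = 2) \<and> i - 1 \<in> x \<and> i \<notin> x \<and> y = insert i (x - {i - 1})"
  "l_step i x = Some y \<longleftrightarrow> (i = 1 \<or> i = 2) \<and> i - 1 \<notin> x \<and> i \<in> x \<and> y = insert (i - 1) (x - {i})"
  "loop_step i x = Some y \<longleftrightarrow> (i = 1 \<or> i = 2) \<and> y = x"
proof -
  have *: "x \<inter> {a, b} = {a} \<longleftrightarrow> a \<in> x \<and> b \<notin> x" "x \<inter> {a, b} = {b} \<longleftrightarrow> a \<notin> x \<and> b \<in> x"
    if "a \<noteq> b" for a b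
    using that by (safe; auto)+
  show "r_step i x = Some y \<longleftrightarrow> (i = 1 \<or> i = 2) \<and> i - 1 \<in> x \<and> i \<notin> x \<and> y = insert i (x - {i - 1})"
  proof (cases "i = 1 \<or> i = 2")
    case True
    then have n: "i - 1 \<noteq> i" by arith
    then show ?thesis using True unfolding r_step_def *(1)[OF n] by auto
  qed (simp add: r_step_def)
  show "l_step i x = Some y \<longleftrightarrow> (i = 1 \<or> i = 2) \<and> i - 1 \<notin> x \<and> i \<in> x \<and> y = insert (i - 1) (x - {i})"
  proof (cases "i = 1 \<or> i = 2")
    case True
    then have n: "i - 1 \<noteq> i" by arith
    then show ?thesis using True unfolding l_step_def *(2)[OF n] by auto
  qed (simp add: l_step_def)
  show "loop_step i x = Some y \<longleftrightarrow> (i = 1 \<or> i = 2) \<and> y = x"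
    unfolding loop_step_def by auto
qed

lemma step_verts_lemmas:
  "x \<in> verts \<Longrightarrow> r_step i x = Some y \<Longrightarrow> y \<in> verts"
  "x \<in> verts \<Longrightarrow> l_step i x = Some y \<Longrightarrow> y \<in> verts"
  "x \<in> verts \<Longrightarrow> loop_step i x = Some y \<Longrightarrow> y \<in> verts"
  by (auto simp: step_Some_iff verts_def)

lemma verts_cases:
  assumes "x \<in> verts"
  obtains "x = {}" | "x = {0}" | "x = {1}" | "x = {2}" | "x = {0, 1}" | "x = {0, 2}" | "x = {1, 2}"
    | "x = {0, 1, 2}"
proof -
  have "verts = {{}, {0}, {1}, {2}, {0, 1}, {0, 2}, {1, 2}, {0, 1, 2}}"
    unfolding verts_def by (auto simp: Pow_insert)
  from assms[unfolded this] show ?thesis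
    by (elim insertE emptyE) (fact that)+
qed

lemma rv_simps [simp]: "rv {} = {}" "rv (insert i x) = insert (2 - i) (rv x)"
  by (simp_all add: rv_def)

lemma step_rv_lemmas:
  "x \<in> verts \<Longrightarrow> r_step i x = Some y \<Longrightarrow> l_step (3 - i) (rv x) = Some (rv y)"
  "x \<in> verts \<Longrightarrow> l_step i x = Some y \<Longrightarrow> r_step (3 - i) (rv x) = Some (rv y)"
  "x \<in> verts \<Longrightarrow> loop_step i x = Some y \<Longrightarrow> loop_step (3 - i) (rv x) = Some (rv y)"
    apply (unfold step_Some_iff)
    apply (elim conjE disjE verts_cases; simp add: insert_commute insert_Diff_if; fail)
   apply (elim conjE disjE verts_cases; simp add: insert_commute insert_Diff_if; fail)
  apply (elim conjE disjE; simp)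
  done

lemma step_rev_lemmas:
  "r_step i x = Some y \<Longrightarrow> l_step i y = Some x"
  "l_step i x = Some y \<Longrightarrow> r_step i y = Some x"
  "loop_step i x = Some y \<Longrightarrow> loop_step i y = Some x"
  by (unfold step_Some_iff) (elim conjE disjE; auto)+

lemma step_index:
  "r_step i x = Some y \<Longrightarrow> i \<in> {1, 2}"
  "l_step i x = Some y \<Longrightarrow> i \<in> {1, 2}"
  "loop_step i x = Some y \<Longrightarrow> i \<in> {1, 2} \<and> y = x"
  unfolding step_Some_iff by blast+

(* Relations common to both algebras; r, l, u are the labels of the arrows R_i, L_i, U_i.
   Being a path forces the indices to lie in {1, 2}. *)
definition base_rels ::
  "(nat \<Rightarrow> 'a::quiver) \<Rightarrow> (nat \<Rightarrow> 'a) \<Rightarrow> (nat \<Rightarrow> 'a) \<Rightarrow> (nat set \<times> 'a list) multiset set" where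
  "base_rels r l u =
     {{#(x, [u i, a]), (x, [a, u i])#} | x i a. is_path x [u i, a]} \<union>
     {{#(x, [r i, l i]), (x, [u i])#} | x i. is_path x [r i, l i]} \<union>
     {{#(x, [l i, r i]), (x, [u i])#} | x i. is_path x [l i, r i]} \<union>
     {{#(x, [r 1, r 2])#} | x. is_path x [r 1, r 2]} \<union>
     {{#(x, [l 2, l 1])#} | x. is_path x [l 2, l 1]} \<union>
     {{#(x, [u i])#} | x i. is_path x [u i] \<and> x \<inter> {i - 1, i} = {}}"

datatype b_lab = R nat | L nat | U nat

(* The primed labels are those of the second algebra, B^!(2). *)
datatype bd_lab = R' nat | L' nat | U' nat | C' nat

instantiation b_lab :: quiver_inv
begin

fun step_b_lab :: "b_lab \<Rightarrow> nat set \<Rightarrow> nat set option" where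
  "step_b_lab (R i) = r_step i"
| "step_b_lab (L i) = l_step i"
| "step_b_lab (U i) = loop_step i"

fun rlab_b_lab :: "b_lab \<Rightarrow> b_lab" where
  "rlab_b_lab (R i) = L (3 - i)"
| "rlab_b_lab (L i) = R (3 - i)"
| "rlab_b_lab (U i) = U (3 - i)"

fun olab_b_lab :: "b_lab \<Rightarrow> b_lab" where
  "olab_b_lab (R i) = L i"
| "olab_b_lab (L i) = R i"
| "olab_b_lab (U i) = U i"

instance
proof
  fix a :: b_lab and x y :: "nat set"
  show "x \<in> verts \<Longrightarrow> step a x = Some y \<Longrightarrow> y \<in> verts"
    by (cases a; simp; rule step_verts_lemmas; assumption)
  show "x \<in> verts \<Longrightarrow> step a x = Some y \<Longrightarrow> step (rlab a) (rv x) = Some (rv y)"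
    by (cases a; simp; rule step_rv_lemmas; assumption)
  show "x \<in> verts \<Longrightarrow> step a x = Some y \<Longrightarrow> step (olab a) y = Some x"
    by (cases a; simp; rule step_rev_lemmas; assumption)
qed

end

instantiation bd_lab :: quiver_inv
begin

fun step_bd_lab :: "bd_lab \<Rightarrow> nat set \<Rightarrow> nat set option" where
  "step_bd_lab (R' i) = r_step i"
| "step_bd_lab (L' i) = l_step i"
| "step_bd_lab (U' i) = loop_step i"
| "step_bd_lab (C' i) = loop_step i"

fun rlab_bd_lab :: "bd_lab \<Rightarrow> bd_lab" where
  "rlab_bd_lab (R' i) = L' (3 - i)"
| "rlab_bd_lab (L' i) = R' (3 - i)"
| "rlab_bd_lab (U' i) = U' (3 - i)"
| "rlab_bd_lab (C' i) = C' (3 - i)"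

fun olab_bd_lab :: "bd_lab \<Rightarrow> bd_lab" where
  "olab_bd_lab (R' i) = L' i"
| "olab_bd_lab (L' i) = R' i"
| "olab_bd_lab (U' i) = U' i"
| "olab_bd_lab (C' i) = C' i"

instance
proof
  fix a :: bd_lab and x y :: "nat set"
  show "x \<in> verts \<Longrightarrow> step a x = Some y \<Longrightarrow> y \<in> verts"
    by (cases a; simp; rule step_verts_lemmas; assumption)
  show "x \<in> verts \<Longrightarrow> step a x = Some y \<Longrightarrow> step (rlab a) (rv x) = Some (rv y)"
    by (cases a; simp; rule step_rv_lemmas; assumption)
  show "x \<in> verts \<Longrightarrow> step a x = Some y \<Longrightarrow> step (olab a) y = Some x"
    by (cases a; simp; rule step_rev_lemmas; assumption)
qed

end

lemma commute_rel_path: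
  fixes a c :: "'a::quiver"
  assumes "step c = loop_step i" "is_path x [c, a]"
  shows "is_path x [a, c]" "run [c, a] x = step a x" "run [a, c] x = step a x"
  using assms by (auto simp: is_path_def loop_step_def split: if_splits bind_splits)

lemma base_rels_cases:
  assumes "\<rho> \<in> base_rels r l u"
  obtains (comm) x i a where "\<rho> = {#(x, [u i, a]), (x, [a, u i])#}" "is_path x [u i, a]"
    | (rl) x i where "\<rho> = {#(x, [r i, l i]), (x, [u i])#}" "is_path x [r i, l i]"
    | (lr) x i where "\<rho> = {#(x, [l i, r i]), (x, [u i])#}" "is_path x [l i, r i]"
    | (rr) x where "\<rho> = {#(x, [r 1, r 2])#}" "is_path x [r 1, r 2]"
    | (ll) x where "\<rho> = {#(x, [l 2, l 1])#}" "is_path x [l 2, l 1]"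
    | (u0) x i where "\<rho> = {#(x, [u i])#}" "is_path x [u i]" "x \<inter> {i - 1, i} = {}"
  using assms unfolding base_rels_def
  by (elim UnE CollectE exE conjE) (erule (1) that | erule (2) that)+

lemma base_rels_path:
  fixes r l u :: "nat \<Rightarrow> 'a::quiver"
  assumes st: "\<And>i. step (r i) = r_step i" "\<And>i. step (l i) = l_step i" "\<And>i. step (u i) = loop_step i"
    and "\<rho> \<in> base_rels r l u" "(x, w) \<in># \<rho>"
  shows "is_path x w"
  using assms(4,5) unfolding base_rels_def
  by (auto simp: commute_rel_path(1)[OF st(3)])
    (auto simp: is_path_def st r_step_def l_step_def loop_step_def split: if_splits bind_splits)

lemma base_rels_rlab:
  fixes r l u :: "nat \<Rightarrow> 'a::quiver_inv"
  assumes st: "\<And>i. step (r i) = r_step i" "\<And>i. step (l i) = l_step i" "\<And>i. step (u i) = loop_step i"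
    and rl: "\<And>i. rlab (r i) = l (3 - i)" "\<And>i. rlab (l i) = r (3 - i)" "\<And>i. rlab (u i) = u (3 - i)"
    and rho: "\<rho> \<in> base_rels r l u"
  shows "image_mset (\<lambda>(x, w). (rv x, map rlab w)) \<rho> \<in> base_rels r l u"
proof -
  from rho show ?thesis
  proof (cases rule: base_rels_cases)
    case (comm x i a)
    have "is_path (rv x) [u (3 - i), rlab a]"
      using is_path_rlab[OF comm(2)] by (simp add: rl)
    then show ?thesis unfolding base_rels_def comm(1) by (auto simp: rl)
  next
    case (rl x i)
    have "is_path (rv x) [l (3 - i), r (3 - i)]"
      using is_path_rlab[OF rl(2)] by (simp add: assms(4-6))
    then show ?thesis unfolding base_rels_def rl(1) by (auto simp: assms(4-6))
  next
    case (lr x i)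
    have "is_path (rv x) [r (3 - i), l (3 - i)]"
      using is_path_rlab[OF lr(2)] by (simp add: rl)
    then show ?thesis unfolding base_rels_def lr(1) by (auto simp: rl)
  next
    case (rr x)
    have "is_path (rv x) [l 2, l 1]"
      using is_path_rlab[OF rr(2)] by (simp add: rl)
    then show ?thesis unfolding base_rels_def rr(1) by (auto simp: rl)
  next
    case (ll x)
    have "is_path (rv x) [r 1, r 2]"
      using is_path_rlab[OF ll(2)] by (simp add: rl)
    then show ?thesis unfolding base_rels_def ll(1) by (auto simp: rl)
  next
    case (u0 x i)
    have "i \<in> {1, 2}" "x \<in> verts"
      using u0(2) by (auto simp: is_path_def st loop_step_def split: if_splits)
    then have "rv x \<inter> {3 - i - 1, 3 - i} = {}"
      using u0(3) by (auto elim!: verts_cases simp: rv_def)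
    moreover have "is_path (rv x) [u (3 - i)]"
      using is_path_rlab[OF u0(2)] by (simp add: rl)
    ultimately have "{#(rv x, [u (3 - i)])#} \<in> base_rels r l u"
      unfolding base_rels_def by blast
    then show ?thesis by (simp add: u0(1) rl)
  qed
qed

lemma base_rels_olab:
  fixes r l u :: "nat \<Rightarrow> 'a::quiver_inv"
  assumes st: "\<And>i. step (r i) = r_step i" "\<And>i. step (l i) = l_step i" "\<And>i. step (u i) = loop_step i"
    and ol: "\<And>i. olab (r i) = l i" "\<And>i. olab (l i) = r i" "\<And>i. olab (u i) = u i"
    and rho: "\<rho> \<in> base_rels r l u"
  shows "image_mset (\<lambda>(x, w). (the (run w x), rev (map olab w))) \<rho> \<in> base_rels r l u"
proof -
  from rho show ?thesis
  proof (cases rule: base_rels_cases)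
    case (comm x i a)
    note c = commute_rel_path[OF st(3) comm(2)]
    have "is_path (the (step a x)) [u i, olab a]"
      using is_path_olab[OF c(1)] unfolding c(3) by (simp add: ol)
    then have "{#(the (step a x), [u i, olab a]), (the (step a x), [olab a, u i])#} \<in> base_rels r l u"
      unfolding base_rels_def by blast
    moreover have "image_mset (\<lambda>(x, w). (the (run w x), rev (map olab w))) \<rho> =
        {#(the (step a x), [u i, olab a]), (the (step a x), [olab a, u i])#}"
      unfolding comm(1) by (simp add: c(2,3) ol add_mset_commute del: run.simps)
    ultimately show ?thesis by simp
  next
    case (rl x i)
    have run: "run [r i, l i] x = Some x" "run [u i] x = Some x"
      using rl(2) by (auto simp: is_path_def st loop_step_def dest: step_rev_lemmas step_index split: bind_splits)
    have "image_mset (\<lambda>(x, w). (the (run w x), rev (map olab w))) \<rho> = \<rho>"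
      unfolding rl(1) using run by (simp add: ol)
    then show ?thesis using rho by simp
  next
    case (lr x i)
    have run: "run [l i, r i] x = Some x" "run [u i] x = Some x"
      using lr(2) by (auto simp: is_path_def st loop_step_def dest: step_rev_lemmas step_index split: bind_splits)
    have "image_mset (\<lambda>(x, w). (the (run w x), rev (map olab w))) \<rho> = \<rho>"
      unfolding lr(1) using run by (simp add: ol)
    then show ?thesis using rho by simp
  next
    case (rr x)
    then show ?thesis
      using is_path_olab[OF rr(2)] unfolding base_rels_def rr(1) by (auto simp: ol)
  next
    case (ll x)
    then show ?thesis
      using is_path_olab[OF ll(2)] unfolding base_rels_def ll(1) by (auto simp: ol)
  next
    case (u0 x i)
    have run: "run [u i] x = Some x"
      using u0(2) by (auto simp: is_path_def st loop_step_def split: if_splits)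
    have "image_mset (\<lambda>(x, w). (the (run w x), rev (map olab w))) \<rho> = \<rho>"
      unfolding u0(1) using run by (simp add: ol)
    then show ?thesis using rho by simp
  qed
qed

instantiation b_lab :: quiver_sym
begin

definition "rels = base_rels R L U"

instance
proof
  fix \<rho> :: "(nat set \<times> b_lab list) multiset" and x w
  assume rho: "\<rho> \<in> rels"
  show "(x, w) \<in># \<rho> \<Longrightarrow> is_path x w"
    by (rule base_rels_path[OF _ _ _ rho[unfolded rels_b_lab_def]]) auto
  show "image_mset (\<lambda>(x, w). (rv x, map rlab w)) \<rho> \<in> rels"
    using rho unfolding rels_b_lab_def by (rule base_rels_rlab[rotated 6]) auto
  show "image_mset (\<lambda>(x, w). (the (run w x), rev (map olab w))) \<rho> \<in> rels"
    using rho unfolding rels_b_lab_def by (rule base_rels_olab[rotated 6]) auto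
qed

end

instantiation bd_lab :: quiver_sym
begin

definition
  "rels = base_rels R' L' U' \<union>
     {{#(x, [C' i, C' i])#} | x i. is_path x [C' i, C' i]} \<union>
     {{#(x, [C' i, a]), (x, [a, C' i])#} | x i a. is_path x [C' i, a]}"

instance
proof
  fix \<rho> :: "(nat set \<times> bd_lab list) multiset" and x w
  assume rho: "\<rho> \<in> rels"
  then consider (base) "\<rho> \<in> base_rels R' L' U'"
    | (cc) x i where "\<rho> = {#(x, [C' i, C' i])#}" "is_path x [C' i, C' i]"
    | (comm) x i a where "\<rho> = {#(x, [C' i, a]), (x, [a, C' i])#}" "is_path x [C' i, a]"
    unfolding rels_bd_lab_def by blast
  note cases = this
  have st: "step (C' i) = loop_step i" for i by (rule ext) simp
  show "is_path x w" if "(x, w) \<in># \<rho>"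
    using cases
  proof cases
    case base
    then show ?thesis
      using that by (rule base_rels_path[rotated 3]) auto
  next
    case (cc x' i)
    then show ?thesis using that by simp
  next
    case (comm x' i a)
    then show ?thesis
      using that commute_rel_path(1)[OF st comm(2)] by auto
  qed
  show "image_mset (\<lambda>(x, w). (rv x, map rlab w)) \<rho> \<in> rels"
    using cases
  proof cases
    case base
    then have "image_mset (\<lambda>(x, w). (rv x, map rlab w)) \<rho> \<in> base_rels R' L' U'"
      by (rule base_rels_rlab[rotated 6]) auto
    then show ?thesis unfolding rels_bd_lab_def by blast
  next
    case (cc x i)
    then show ?thesis
      using is_path_rlab[OF cc(2)] unfolding rels_bd_lab_def by auto
  next
    case (comm x i a)
    then show ?thesis
      using is_path_rlab[OF comm(2)] unfolding rels_bd_lab_def by auto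
  qed
  show "image_mset (\<lambda>(x, w). (the (run w x), rev (map olab w))) \<rho> \<in> rels"
    using cases
  proof cases
    case base
    then have "image_mset (\<lambda>(x, w). (the (run w x), rev (map olab w))) \<rho> \<in> base_rels R' L' U'"
      by (rule base_rels_olab[rotated 6]) auto
    then show ?thesis unfolding rels_bd_lab_def by blast
  next
    case (cc x i)
    then show ?thesis
      using is_path_olab[OF cc(2)] unfolding rels_bd_lab_def by auto
  next
    case (comm x i a)
    note c = commute_rel_path[OF st comm(2)]
    have "is_path (the (step a x)) [C' i, olab a]"
      using is_path_olab[OF c(1)] unfolding c(3) by simp
    then have "{#(the (step a x), [C' i, olab a]), (the (step a x), [olab a, C' i])#} \<in> rels"
      unfolding rels_bd_lab_def by blast
    moreover have "image_mset (\<lambda>(x, w). (the (run w x), rev (map olab w))) \<rho> =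
        {#(the (step a x), [C' i, olab a]), (the (step a x), [olab a, C' i])#}"
      unfolding comm(1) by (simp add: c(2,3) add_mset_commute del: run.simps)
    ultimately show ?thesis by simp
  qed
qed

end

type_synonym b2 = "b_lab quiver_alg"

type_synonym bd2 = "bd_lab quiver_alg"

(* The terms of the differential of a word: each C_i in turn is replaced by U_i. *)
fun dwords :: "bd_lab list \<Rightarrow> bd_lab list list" where
  "dwords [] = []"
| "dwords (C' i # w) = (U' i # w) # map ((#) (C' i)) (dwords w)"
| "dwords (a # w) = map ((#) a) (dwords w)"

definition path_d :: "(bd_lab path \<Rightarrow>\<^sub>0 bit) \<Rightarrow> bd_lab path \<Rightarrow>\<^sub>0 bit" where
  "path_d = lin (\<lambda>p. \<Sum>w\<leftarrow>dwords (word p). pth (src p) w)"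

lemma dwords_append:
  "dwords (v @ w) = map (\<lambda>v'. v' @ w) (dwords v) @ map ((@) v) (dwords w)"
  by (induction v rule: dwords.induct) simp_all

lemma run_dwords: "w' \<in> set (dwords w) \<Longrightarrow> run w' x = run w x"
  by (induction w arbitrary: x w' rule: dwords.induct) (auto simp: loop_step_def intro!: Option.bind_cong)

lemma path_d_add: "path_d (u + v) = path_d u + path_d v"
  and path_d_0 [simp]: "path_d 0 = 0"
  by (simp_all add: path_d_def lin_add)

lemma path_d_pth: "path_d (pth x w) = (\<Sum>w'\<leftarrow>dwords w. pth x w')"
proof (cases "is_path x w")
  case True
  then show ?thesis by (simp add: path_d_def lin_pth)
next
  case False
  have "pth x w' = 0" if "w' \<in> set (dwords w)" for w'
    using False run_dwords[OF that, of x] by (auto simp: is_path_def pth_def)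
  then have "(\<Sum>w'\<leftarrow>dwords w. pth x w') = (\<Sum>w'\<leftarrow>dwords w. 0)"
    by (intro arg_cong[where f = sum_list] map_cong) auto
  then show ?thesis using False by (simp add: pth_eq_0)
qed

lemma pmult_sum_list_left: "pmult (sum_list us) v = (\<Sum>u\<leftarrow>us. pmult u v)"
  by (induction us) (simp_all add: pmult_add_left)

lemma pmult_sum_list_right: "pmult v (sum_list us) = (\<Sum>u\<leftarrow>us. pmult v u)"
  by (induction us) (simp_all add: pmult_add_right)

lemma path_d_mult: "path_d (pmult u v) = pmult (path_d u) v + pmult u (path_d v)"
proof (induction u rule: path_alg_induct)
  case u: (pth x w)
  show ?case
  proof (induction v rule: path_alg_induct)
    case v: (pth y w')
    let ?c = "x \<in> verts \<and> run w x = Some y"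
    have 1: "pmult (path_d (pth x w)) (pth y w') = (\<Sum>t\<leftarrow>dwords w. if ?c then pth x (t @ w') else 0)"
      unfolding path_d_pth pmult_sum_list_left map_map comp_def
      by (intro arg_cong[where f = sum_list] map_cong refl) (simp add: pmult_pth run_dwords)
    have 2: "pmult (pth x w) (path_d (pth y w')) = (\<Sum>t\<leftarrow>dwords w'. if ?c then pth x (w @ t) else 0)"
      unfolding path_d_pth pmult_sum_list_right map_map comp_def
      by (intro arg_cong[where f = sum_list] map_cong refl) (simp add: pmult_pth)
    show ?case
    proof (cases ?c)
      case True
      then have "pmult (pth x w) (pth y w') = pth x (w @ w')" by (simp add: pmult_pth)
      then show ?thesis
        unfolding 1 2 using True by (simp add: path_d_pth dwords_append comp_def)
    next
      case False
      then have "pmult (pth x w) (pth y w') = 0" by (auto simp: pmult_pth)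
      then show ?thesis
        unfolding 1 2 using False by (simp only: if_False path_d_0) (simp add: sum_list_0)
    qed
  qed (simp_all add: pmult_add_right path_d_add add_ac)
qed (simp_all add: pmult_add_left path_d_add add_ac)

lemma path_d_rel:
  assumes "\<rho> \<in> rels"
  shows "path_d (rel_elem \<rho>) \<in> ideal"
proof -
  have commI: "pth x [b, a] + pth x [a, b] \<in> ideal"
    if "is_path x [b, a]" "b = U' i \<or> b = C' i" for x i a b
  proof -
    have "{#(x, [b, a]), (x, [a, b])#} \<in> rels"
      using that unfolding rels_bd_lab_def base_rels_def by blast
    then have "rel_elem {#(x, [b, a]), (x, [a, b])#} \<in> ideal" by (rule rel_elem_ideal)
    then show ?thesis by (simp add: rel_elem_def)
  qed
  from assms consider (base) "\<rho> \<in> base_rels R' L' U'"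
    | (cc) x i where "\<rho> = {#(x, [C' i, C' i])#}" "is_path x [C' i, C' i]"
    | (comm) x i a where "\<rho> = {#(x, [C' i, a]), (x, [a, C' i])#}" "is_path x [C' i, a]"
    unfolding rels_bd_lab_def by blast
  then show ?thesis
  proof cases
    case base
    then show ?thesis
    proof (cases rule: base_rels_cases)
      case (comm x i a)
      show ?thesis
      proof (cases a)
        case (C' j)
        have "is_path x [U' i, U' j]"
          using comm(2) by (auto simp: is_path_def C' loop_step_def split: bind_splits if_splits)
        from commI[OF this, of i] show ?thesis
          by (simp add: comm(1) rel_elem_def path_d_add path_d_pth C')
      qed (simp_all add: comm(1) rel_elem_def path_d_add path_d_pth ideal_0)
    qed (simp_all add: rel_elem_def path_d_add path_d_pth ideal_0)
  next
    case (cc x i)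
    have "is_path x [C' i, U' i]"
      using cc(2) by (auto simp: is_path_def loop_step_def split: bind_splits if_splits)
    from commI[OF this, of i] show ?thesis
      by (simp add: cc(1) rel_elem_def path_d_pth add.commute)
  next
    case c: (comm x i a)
    show ?thesis
    proof (cases a)
      case (C' j)
      have "is_path x [U' i, C' j]" "is_path x [U' j, C' i]"
        using c(2) by (auto simp: is_path_def C' loop_step_def split: bind_splits if_splits)
      then have "(pth x [U' i, C' j] + pth x [C' j, U' i]) + (pth x [U' j, C' i] + pth x [C' i, U' j]) \<in> ideal"
        by (intro ideal_add commI) auto
      then show ?thesis
        by (simp add: c(1) rel_elem_def path_d_add path_d_pth C' add_ac)
    next
      case (R' j)
      have "is_path x [U' i, a]" using c(2) by (auto simp: is_path_def loop_step_def split: bind_splits if_splits)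
      from commI[OF this, of i] show ?thesis
        by (simp add: c(1) rel_elem_def path_d_add path_d_pth R')
    next
      case (L' j)
      have "is_path x [U' i, a]" using c(2) by (auto simp: is_path_def loop_step_def split: bind_splits if_splits)
      from commI[OF this, of i] show ?thesis
        by (simp add: c(1) rel_elem_def path_d_add path_d_pth L')
    next
      case (U' j)
      have "is_path x [U' i, a]" using c(2) by (auto simp: is_path_def loop_step_def split: bind_splits if_splits)
      from commI[OF this, of i] show ?thesis
        by (simp add: c(1) rel_elem_def path_d_add path_d_pth U')
    qed
  qed
qed

lemma path_d_ideal: "r \<in> ideal \<Longrightarrow> path_d r \<in> ideal"
proof (subst (asm) ideal_def, induction rule: f2_span_induct)
  case (base s)
  then obtain u v \<rho> where s: "s = pmult (pmult u (rel_elem \<rho>)) v" "\<rho> \<in> rels" by auto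
  then show ?case
    by (simp add: s path_d_mult ideal_add ideal_mult_left ideal_mult_right path_d_rel rel_elem_ideal)
qed (simp_all add: path_d_add ideal_0 ideal_add)

lift_definition bd2_diff :: "bd2 \<Rightarrow> bd2" is path_d
  by (simp add: f2_diff path_d_ideal flip: path_d_add)

lemma bd2_diff_add: "bd2_diff (a + b) = bd2_diff a + bd2_diff b"
  and bd2_diff_mult: "bd2_diff (a * b) = bd2_diff a * b + a * bd2_diff b"
  by (transfer; simp add: path_d_add path_d_mult ideal_0)+

lemma bd2_diff_path_elem: "bd2_diff (path_elem x w) = (\<Sum>w'\<leftarrow>dwords w. path_elem x w')"
proof -
  have "bd2_diff (abs_quiver_alg (pth x w)) = abs_quiver_alg (\<Sum>w'\<leftarrow>dwords w. pth x w')"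
    by (simp add: bd2_diff.abs_eq path_d_pth)
  moreover have "abs_quiver_alg (sum_list us) = (\<Sum>u\<leftarrow>us. abs_quiver_alg u)"
    for us :: "(bd_lab path \<Rightarrow>\<^sub>0 bit) list"
    by (induction us) (simp_all add: zero_quiver_alg.abs_eq flip: plus_quiver_alg.abs_eq)
  ultimately show ?thesis by (simp add: path_elem.abs_eq comp_def)
qed

section \<open>The bimodule and its symmetries\<close>

type_synonym bb2 = "(b2, bd2) tensor"

definition tensor_R :: "bb2 \<Rightarrow> bb2" where
  "tensor_R = tensor_map alg_R alg_R"

(* The tensor product of B^op and (B^!)^op is identified with the opposite of the tensor product
   of B and B^!, a^op (x) b^op corresponding to (a (x) b)^op. *)
definition tensor_o :: "bb2 \<Rightarrow> bb2 op" where
  "tensor_o t = Op (tensor_map alg_o alg_o t)"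

lemma additive_alg [simp]: "additive alg_R" "additive alg_o"
  by (simp_all add: additive_def alg_R_add alg_o_add)

lemma tensor_R_tens [simp]: "tensor_R (a \<otimes> b) = alg_R a \<otimes> alg_R b"
  by (simp add: tensor_R_def tensor_map_tens)

lemma tensor_R_add: "tensor_R (s + t) = tensor_R s + tensor_R t"
  by (simp add: tensor_R_def tensor_map_add)

lemma tensor_R_mult: "tensor_R (s * t) = tensor_R s * tensor_R t"
proof (induction s rule: tensor_induct)
  case (tens a b)
  show ?case
    by (induction t rule: tensor_induct)
      (simp_all add: tensor_R_add tens_mult alg_R_mult distrib_left)
qed (simp add: tensor_R_add distrib_right)

lemma tensor_o_tens [simp]: "tensor_o (a \<otimes> b) = Op (alg_o a \<otimes> alg_o b)"
  by (simp add: tensor_o_def tensor_map_tens)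

lemma tensor_o_add: "tensor_o (s + t) = tensor_o s + tensor_o t"
  by (simp add: tensor_o_def tensor_map_add plus_op_def)

lemma tensor_o_mult: "tensor_o (s * t) = tensor_o s * tensor_o t"
proof (induction s rule: tensor_induct)
  case (tens a b)
  show ?case
    by (induction t rule: tensor_induct)
      (simp_all add: tensor_o_add tens_mult alg_o_mult distrib_left, simp add: times_op_def tens_mult)
qed (simp add: tensor_o_add distrib_right)

(* Z1, Z4, X1, ..., Y8 stand for z_1, z_4, x_1, ..., y_8. *)
datatype gen = Z1 | Z4 | X1 | X2 | X3 | X6 | X7 | X10 | X11 | X12
  | Y1 | Y2 | Y4 | Y5 | Y7 | Y8

instance gen :: finite
proof
  have "(UNIV :: gen set) = {Z1, Z4, X1, X2, X3, X6, X7, X10, X11, X12, Y1, Y2, Y4, Y5, Y7, Y8}"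
    by (auto intro: gen.exhaust)
  then show "finite (UNIV :: gen set)" by (metis finite.emptyI finite_insert)
qed

instantiation gen :: idem_basis
begin

fun idems_gen :: "gen \<Rightarrow> nat set \<times> nat set" where
  "idems_gen Z1 = ({}, {0, 1, 2})"
| "idems_gen Z4 = ({}, {0, 1, 2})"
| "idems_gen X1 = ({0}, {1, 2})"
| "idems_gen X2 = ({2}, {0, 1})"
| "idems_gen X3 = ({1}, {1, 2})"
| "idems_gen X6 = ({1}, {0, 1})"
| "idems_gen X7 = ({1}, {1, 2})"
| "idems_gen X10 = ({1}, {0, 1})"
| "idems_gen X11 = ({0}, {1, 2})"
| "idems_gen X12 = ({2}, {0, 1})"
| "idems_gen Y1 = ({0, 2}, {1})"
| "idems_gen Y2 = ({1, 2}, {1})"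
| "idems_gen Y4 = ({0, 1}, {1})"
| "idems_gen Y5 = ({1, 2}, {1})"
| "idems_gen Y7 = ({0, 1}, {1})"
| "idems_gen Y8 = ({0, 2}, {1})"

instance ..

end

(* (a, b, y) in terms x stands for the term (a (x) b) (x) y of the image of x, the words a and b
   being read as paths starting at the idempotents of x; the empty word is the idempotent itself. *)
fun terms :: "gen \<Rightarrow> (b_lab list \<times> bd_lab list \<times> gen) list" where
  "terms Z1 = []"
| "terms Z4 = []"
| "terms X1 = [([R 1], [L' 1, L' 2], X6), ([R 1], [U' 1, C' 2], X7)]"
| "terms X2 = [([L 2], [R' 2, R' 1], X3), ([L 2], [C' 1, U' 2], X10)]"
| "terms X3 = [([L 1], [], X1), ([], [L' 1, L' 2], X10), ([L 1], [U' 1, C' 2], X11)]"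
| "terms X6 = [([R 2], [], X2), ([], [R' 2, R' 1], X7), ([R 2], [C' 1, U' 2], X12)]"
| "terms X7 = [([U 2], [], X3), ([R 2], [L' 1, L' 2], X12)]"
| "terms X10 = [([U 1], [], X6), ([L 1], [R' 2, R' 1], X11)]"
| "terms X11 = [([R 1], [], X7)]"
| "terms X12 = [([L 2], [], X10)]"
| "terms Y1 = [([R 1, U 2], [C' 1, C' 2], Y2), ([L 2, U 1], [C' 1, C' 2], Y4),
     ([R 1], [U' 1, C' 2], Y5), ([L 2], [C' 1, U' 2], Y7)]"
| "terms Y2 = [([L 1], [], Y1), ([L 1, L 2], [C' 1, C' 2], Y7), ([L 1], [U' 1, C' 2], Y8)]"
| "terms Y4 = [([R 2], [], Y1), ([R 2, R 1], [C' 1, C' 2], Y5), ([R 2], [C' 1, U' 2], Y8)]"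
| "terms Y5 = [([U 2], [], Y2), ([L 1, L 2], [], Y4), ([L 1, U 2], [C' 1, C' 2], Y8)]"
| "terms Y7 = [([R 2, R 1], [], Y2), ([U 1], [], Y4), ([R 2, U 1], [C' 1, C' 2], Y8)]"
| "terms Y8 = [([R 1], [], Y5), ([L 2], [], Y7)]"

lemma terms_paths:
  assumes "(a, b, y) \<in> set (terms x)"
  shows "is_path (fst (idems x)) a" "run a (fst (idems x)) = Some (fst (idems y))"
    and "is_path (snd (idems x)) b" "run b (snd (idems x)) = Some (snd (idems y))"
  using assms
  by (cases x;
      auto simp: is_path_def verts_def r_step_def l_step_def loop_step_def insert_Diff_if insert_commute)+

(* coeff x y is the sum of all a (x) b for which (a (x) b) (x) y is a term of the image of x. *)
definition coeff :: "gen \<Rightarrow> gen \<Rightarrow> bb2" where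
  "coeff x y = (\<Sum>(a, b, z)\<leftarrow>terms x.
     if z = y then path_elem (fst (idems x)) a \<otimes> path_elem (snd (idems x)) b else 0)"

definition dd_op :: "('g \<Rightarrow> 'g \<Rightarrow> 'a) \<Rightarrow> ('g \<Rightarrow>\<^sub>0 bit) \<Rightarrow> ('a::idem2_alg, 'g::{idem_basis, finite}) dtensor"
  where "dd_op c = lin (\<lambda>x. \<Sum>y\<in>UNIV. c x y \<otimes>\<^sub>I basis y)"

datatype 'g dual = Dual (undual: 'g)

instance dual :: (finite) finite
proof
  have "(UNIV :: 'a dual set) = range Dual"
    by (metis UNIV_eq_I dual.collapse rangeI)
  then show "finite (UNIV :: 'a dual set)" by (metis finite finite_imageI)
qed

instantiation dual :: (idem_basis) idem_basis
begin
definition "idems g = idems (undual g)"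
instance ..
end

(* Reversing arrows transposes the coefficient matrix. *)
definition dual_coeff :: "('g \<Rightarrow> 'g \<Rightarrow> 'a) \<Rightarrow> 'g dual \<Rightarrow> 'g dual \<Rightarrow> 'a op" where
  "dual_coeff c y x = Op (c (undual x) (undual y))"

definition delta1 :: "(gen \<Rightarrow>\<^sub>0 bit) \<Rightarrow> (bb2, gen) dtensor" where
  "delta1 = dd_op coeff"

definition delta1_dual :: "(gen dual \<Rightarrow>\<^sub>0 bit) \<Rightarrow> (bb2 op, gen dual) dtensor" where
  "delta1_dual = dd_op (dual_coeff coeff)"

fun gen_R :: "gen \<Rightarrow> gen" where
  "gen_R Z1 = Z1" | "gen_R Z4 = Z4" | "gen_R Y1 = Y1" | "gen_R Y8 = Y8"
| "gen_R X1 = X2" | "gen_R X2 = X1"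
| "gen_R X3 = X6" | "gen_R X6 = X3"
| "gen_R X7 = X10" | "gen_R X10 = X7"
| "gen_R X11 = X12" | "gen_R X12 = X11"
| "gen_R Y2 = Y4" | "gen_R Y4 = Y2"
| "gen_R Y5 = Y7" | "gen_R Y7 = Y5"

fun gen_o :: "gen \<Rightarrow> gen" where
  "gen_o Z1 = Z4" | "gen_o Z4 = Z1"
| "gen_o X1 = X11" | "gen_o X11 = X1"
| "gen_o X2 = X12" | "gen_o X12 = X2"
| "gen_o X3 = X7" | "gen_o X7 = X3"
| "gen_o X6 = X10" | "gen_o X10 = X6"
| "gen_o Y1 = Y8" | "gen_o Y8 = Y1"
| "gen_o Y2 = Y5" | "gen_o Y5 = Y2"
| "gen_o Y4 = Y7" | "gen_o Y7 = Y4"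

definition X_R :: "(gen \<Rightarrow>\<^sub>0 bit) \<Rightarrow> gen \<Rightarrow>\<^sub>0 bit" where
  "X_R = lin (\<lambda>g. basis (gen_R g))"

definition X_o :: "(gen \<Rightarrow>\<^sub>0 bit) \<Rightarrow> gen dual \<Rightarrow>\<^sub>0 bit" where
  "X_o = lin (\<lambda>g. basis (Dual (gen_o g)))"

lemma idems_gen_R: "idems (gen_R g) = map_prod rv rv (idems g)"
  by (cases g) (simp_all add: insert_commute)

lemma idems_gen_o: "idems (gen_o g) = idems g"
  by (cases g) simp_all

lemma idems_verts: "idems (g :: gen) \<in> verts \<times> verts"
  by (cases g) (simp_all add: verts_def)

lemma rv_rv: "x \<in> verts \<Longrightarrow> rv (rv x) = x"
  by (elim verts_cases) (simp_all add: insert_commute)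

lemma rv_inj: "x \<in> verts \<Longrightarrow> y \<in> verts \<Longrightarrow> rv x = rv y \<longleftrightarrow> x = y"
  using rv_rv by metis

lemma X_R_X_R: "X_R (X_R u) = u"
proof (induction u rule: free_induct)
  case (basis g)
  show ?case by (cases g) (simp_all add: X_R_def)
qed (simp_all add: X_R_def lin_add)

lemma idem_compat_R: "idem_compat tensor_R X_R"
  unfolding idem_compat_def
proof (intro exI[of _ "map_prod rv rv"] ballI conjI allI)
  fix e :: "nat set \<times> nat set"
  assume e: "e \<in> verts \<times> verts"
  show "map_prod rv rv e \<in> verts \<times> verts" using e by (auto simp: rv_verts)
  have "tensor_R (idem2 e) = idem2 (map_prod rv rv e)"
    using e by (auto simp: idem2_tensor_def idem_quiver_alg_def alg_R_path_elem is_path_def)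
  then show "tensor_R (a * idem2 e) = tensor_R a * idem2 (map_prod rv rv e)" for a
    by (simp add: tensor_R_mult)
  have iff: "idems (gen_R g) = map_prod rv rv e \<longleftrightarrow> idems g = e" for g
    using e idems_verts[of g] by (cases e; cases "idems g") (simp add: idems_gen_R rv_inj)
  show "X_R (idem_act e u) = idem_act (map_prod rv rv e) (X_R u)" for u
    by (induction u rule: free_induct) (simp_all add: X_R_def idem_act_def lin_add iff)
qed

lemma idem_compat_o: "idem_compat tensor_o X_o"
  unfolding idem_compat_def
proof (intro exI[of _ id] ballI conjI allI)
  fix e :: "nat set \<times> nat set"
  assume e: "e \<in> verts \<times> verts"
  then show "id e \<in> verts \<times> verts" by simp
  have "tensor_o (idem2 e) = idem2 e"
    using e by (auto simp: idem2_tensor_def idem2_op_def idem_quiver_alg_def alg_o_path_elem is_path_def)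
  then show "tensor_o (a * idem2 e) = tensor_o a * idem2 (id e)" for a
    by (simp add: tensor_o_mult)
  show "X_o (idem_act e u) = idem_act (id e) (X_o u)" for u
    by (induction u rule: free_induct)
      (simp_all add: X_o_def idem_act_def lin_add idems_dual_def idems_gen_o)
qed

lemma additive_maps:
  "additive tensor_R" "additive X_R" "additive tensor_o" "additive X_o"
  by (simp_all add: additive_def tensor_R_add tensor_o_add X_R_def X_o_def lin_add)

lemmas dtensor_map_R = dtensor_map_dtens[OF additive_maps(1,2) idem_compat_R]
  and dtensor_map_R_add = dtensor_map_add[OF additive_maps(1,2) idem_compat_R]
  and dtensor_map_o = dtensor_map_dtens[OF additive_maps(3,4) idem_compat_o]
  and dtensor_map_o_add = dtensor_map_add[OF additive_maps(3,4) idem_compat_o]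

end

theory Submission
  imports Defs
begin

text \<open>The maps are additive and the operations are given by coefficient matrices, so each symmetry
  reduces to an identity between matrix entries. These hold label by label, up to moving the
  central labels \<open>U\<^sub>i\<close> and \<open>C\<^sub>i\<close> past the other labels.\<close>

lemma path_elem_commute:
  assumes "{#(x, [c, a]), (x, [a, c])#} \<in> rels"
  shows "path_elem x [a, c] = path_elem x [c, a]"
proof -
  have "pth x [c, a] + pth x [a, c] \<in> ideal"
    using rel_elem_ideal[OF assms] by (simp add: rel_elem_def)
  then show ?thesis
    by (simp add: path_elem.abs_eq quiver_alg.abs_eq_iff f2_diff add.commute)
qed

lemma U_commute: "is_path x [U i, a] \<Longrightarrow> path_elem x [U i, a] = path_elem x [a, U i]"
  by (rule path_elem_commute[symmetric]) (auto simp: rels_b_lab_def base_rels_def)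

lemma C'_commute: "is_path x [C' i, a] \<Longrightarrow> path_elem x [a, C' i] = path_elem x [C' i, a]"
  by (rule path_elem_commute) (auto simp: rels_bd_lab_def)

(* Restricted instances: as a rewrite rule, U_commute loops on two U's, and C'_commute on two C's. *)
lemmas U_past = U_commute[of _ _ "R j" for j] U_commute[of _ _ "L j" for j]
  and C'_past = C'_commute[of _ _ "U' j" for j] C'_commute[of _ "Suc 0" "C' 2"]

lemma tensor_R_0 [simp]: "tensor_R 0 = 0"
  by (rule additive.zero[OF additive_maps(1)])

lemma tensor_o_0 [simp]: "tensor_o 0 = Op 0"
  using additive.zero[OF additive_maps(3)] by (simp add: zero_op_def)

lemmas step_simps = is_path_def verts_def r_step_def l_step_def loop_step_def
  insert_Diff_if insert_commute

lemma coeff_gen_R: "coeff (gen_R x) (gen_R y) = tensor_R (coeff x y)"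
  by (cases x; simp add: coeff_def; cases y;
      simp add: alg_R_path_elem step_simps U_past C'_past)

lemma coeff_gen_o: "Op (coeff (gen_o y) (gen_o x)) = tensor_o (coeff x y)"
  by (cases x; cases y; simp add: coeff_def;
      simp add: alg_o_path_elem step_simps U_past C'_past)

lemma gen_R_bij: "bij gen_R"
proof (rule o_bij)
  have "gen_R (gen_R g) = g" for g
    by (cases g) simp_all
  then show "gen_R \<circ> gen_R = id" "gen_R \<circ> gen_R = id"
    by (simp_all add: fun_eq_iff)
qed

lemma gen_o_bij: "bij (\<lambda>g. Dual (gen_o g))"
proof (rule o_bij)
  have inv: "gen_o (gen_o g) = g" for g
    by (cases g) simp_all
  show "(\<lambda>g. gen_o (undual g)) \<circ> (\<lambda>g. Dual (gen_o g)) = id"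
    and "(\<lambda>g. Dual (gen_o g)) \<circ> (\<lambda>g. gen_o (undual g)) = id"
    by (simp_all add: fun_eq_iff inv)
qed

lemma dd_op_basis: "dd_op c (basis x) = (\<Sum>y\<in>UNIV. c x y \<otimes>\<^sub>I basis y)"
  by (simp add: dd_op_def)

lemma dd_op_map:
  fixes \<pi> :: "'g::{idem_basis, finite} \<Rightarrow> 'h::{idem_basis, finite}"
  assumes f: "additive f" and c: "idem_compat f (lin (\<lambda>g. basis (\<pi> g)))"
    and \<pi>: "bij \<pi>" and coeff: "\<And>x y. d (\<pi> x) (\<pi> y) = f (c x y)"
  shows "dd_op d \<circ> lin (\<lambda>g. basis (\<pi> g)) = dtensor_map f (lin (\<lambda>g. basis (\<pi> g))) \<circ> dd_op c"
proof
  fix u :: "'g \<Rightarrow>\<^sub>0 bit"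
  let ?h = "lin (\<lambda>g. basis (\<pi> g))"
  note map = f additive_lin c
  have add: "additive (dtensor_map f ?h)"
    by standard (rule dtensor_map_add[OF map])
  have "dd_op d (basis (\<pi> x)) = dtensor_map f ?h (dd_op c (basis x))" for x
  proof -
    have "dd_op d (basis (\<pi> x)) = (\<Sum>y\<in>UNIV. d (\<pi> x) (\<pi> y) \<otimes>\<^sub>I basis (\<pi> y))"
      unfolding dd_op_basis by (rule sum.reindex_bij_betw[OF \<pi>, symmetric])
    also have "\<dots> = dtensor_map f ?h (dd_op c (basis x))"
      by (simp add: dd_op_basis additive.sum[OF add] dtensor_map_dtens[OF map] coeff)
    finally show ?thesis .
  qed
  then have "dd_op d (?h u) = dtensor_map f ?h (dd_op c u)"
    by (induction u rule: free_induct)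
      (simp_all add: dd_op_def lin_add additive.zero[OF add] additive.add[OF add])
  then show "(dd_op d \<circ> ?h) u = (dtensor_map f ?h \<circ> dd_op c) u" by simp
qed

theorem mainTheorem5:
  shows "delta1 \<circ> X_R = dtensor_map tensor_R X_R \<circ> delta1 \<and>
    delta1_dual \<circ> X_o = dtensor_map tensor_o X_o \<circ> delta1"
  unfolding delta1_def delta1_dual_def X_R_def X_o_def
  by (intro conjI dd_op_map additive_maps gen_R_bij gen_o_bij
      idem_compat_R[unfolded X_R_def] idem_compat_o[unfolded X_o_def])
    (simp_all add: coeff_gen_R coeff_gen_o dual_coeff_def)

end
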